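(* Let $P_1,P_2$ be non-commutative Poisson algebras over $K$ of the same class (both of Class 1 or both of Class 2), with degree maps $u_i:P_i\to\mathbb Z_{\ge0}\cup\{-\infty\}$ ($i=1,2$) whose induced filtrations are finite and discrete. Let $z_1\in P_1$, $z_2\in P_2$ and $\Gamma=z_1\otimes1+1\otimes z_2\in P_1\otimes P_2$. Then $$F(\Gamma)=F(z_1)\otimes F(z_2).$$
   Context: $K$ is an algebraically closed field of characteristic zero; tensor products are over $K$. A non-commutative Poisson algebra over $K$ is a $K$-vector space $P$ with a bilinear product $\cdot$ making it a unital associative (not necessarily commutative) $K$-algebra and a bilinear bracket $\{\cdot,\cdot\}$ making it a Lie algebra, such that $\{x,yz\}=\{x,y\}z+y\{x,z\}$ for all $x,y,z\in P$. It is of Class 1 if $(P,\cdot)$ is commutative, and of Class 2 if $(P,\cdot)$ is non-commutative and $\{a,b\}=ab-ba$ for all $a,b$. Tensor product: if $P_1,P_2$ are both of Class 1, $P_1\otimes P_2$ carries the bracket $\{a_1\otimes a_2,b_1\otimes b_2\}=\{a_1,b_1\}\otimes a_2b_2+b_1a_1\otimes\{a_2,b_2\}$; if both are of Class 2, the bracket on $P_1\otimes P_2$ is the commutator. This makes $P_1\otimes P_2$ a non-commutative Poisson algebra of the same class. A degree map on $P$ is a map $u:P\to\mathbb Z\cup\{-\infty\}$ such that for all $z,w\in P$: $u(\{z,w\})\le u(zw)=u(z)+u(w)$; $u(z+w)\le\max\{u(z),u(w)\}$; $u(z)=-\infty$ iff $z=0$. Its induced filtration is $P_t=\{a\in P\mid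 u(a)\le t\}$, $t\in\mathbb Z$; it is finite if every $P_t$ is finite dimensional over $K$ and discrete if $P_t=\{0\}$ for all $t<0$. For an element $z$ of a non-commutative Poisson algebra $P$ put $ad_z(w)=\{z,w\}$ and $F(z)=\{x\in P\mid \dim_K K[ad_z](x)<\infty\}$. For $z_i$ this is formed in $P_i$; for $\Gamma$ it is formed in $P_1\otimes P_2$. *)

theory Defs
  imports
    "HOL-Computational_Algebra.Polynomial"
    "HOL-Library.Extended"
    "HOL-Library.Function_Algebras"
begin

section \<open>Non-commutative Poisson algebras\<close>

definition bilinear_map ::
  "('k::field \<Rightarrow> 'a::ab_group_add \<Rightarrow> 'a) \<Rightarrow> ('k \<Rightarrow> 'b::ab_group_add \<Rightarrow> 'b) \<Rightarrow>
   ('k \<Rightarrow> 'c::ab_group_add \<Rightarrow> 'c) \<Rightarrow> ('a \<Rightarrow> 'b \<Rightarrow> 'c) \<Rightarrow> bool"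
  where "bilinear_map s1 s2 s3 f \<longleftrightarrow>
    (\<forall>y. Vector_Spaces.linear s1 s3 (\<lambda>x. f x y)) \<and> (\<forall>x. Vector_Spaces.linear s2 s3 (f x))"

text \<open>The carrier is a type of sort \<open>{ring, monoid_mult}\<close> rather than \<open>ring_1\<close>, because
  \<open>ring_1\<close> excludes the zero algebra.\<close>

locale nc_poisson_algebra = vector_space scale
  for scale :: "'k::field \<Rightarrow> 'p::{ring, monoid_mult} \<Rightarrow> 'p" +
  fixes bracket :: "'p \<Rightarrow> 'p \<Rightarrow> 'p"
  assumes mult_bilinear: "bilinear_map scale scale scale (*)"
    and bracket_bilinear: "bilinear_map scale scale scale bracket"
    and bracket_self: "bracket x x = 0"
    and jacobi: "bracket x (bracket y z) + bracket y (bracket z x) + bracket z (bracket x y) = 0"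
    and leibniz: "bracket x (y * z) = bracket x y * z + y * bracket x z"

text \<open>Class 1 is a condition on the product only; the bracket is an argument so that it and
  \<open>class_2\<close> apply to the same data.\<close>

definition class_1 :: "('p::{ring, monoid_mult} \<Rightarrow> 'p \<Rightarrow> 'p) \<Rightarrow> bool"
  where "class_1 bracket \<longleftrightarrow> (\<forall>a b :: 'p. a * b = b * a)"

definition class_2 :: "('p::{ring, monoid_mult} \<Rightarrow> 'p \<Rightarrow> 'p) \<Rightarrow> bool"
  where "class_2 bracket \<longleftrightarrow>
    \<not> (\<forall>a b :: 'p. a * b = b * a) \<and> (\<forall>a b. bracket a b = a * b - b * a)"


section \<open>Degree maps\<close>

text \<open>The set of integers together with minus infinity is the type \<open>int extended\<close> without
  the point \<open>Pinf\<close>.\<close>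

definition degree_map :: "('p::{ring, monoid_mult} \<Rightarrow> 'p \<Rightarrow> 'p) \<Rightarrow> ('p \<Rightarrow> int extended) \<Rightarrow> bool"
  where "degree_map bracket u \<longleftrightarrow>
    (\<forall>z. u z \<noteq> Pinf) \<and>
    (\<forall>z w. u (bracket z w) \<le> u (z * w)) \<and>
    (\<forall>z w. u (z * w) = u z + u w) \<and>
    (\<forall>z w. u (z + w) \<le> max (u z) (u w)) \<and>
    (\<forall>z. u z = Minf \<longleftrightarrow> z = 0)"

definition filtration :: "('p \<Rightarrow> int extended) \<Rightarrow> int \<Rightarrow> 'p set"
  where "filtration u t = {a. u a \<le> Fin t}"

definition fin_dim :: "('k::field \<Rightarrow> 'v::ab_group_add \<Rightarrow> 'v) \<Rightarrow> 'v set \<Rightarrow> bool"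
  where "fin_dim scale V \<longleftrightarrow> (\<exists>B. finite B \<and> module.span scale B = V)"

definition finite_filtration ::
  "('k::field \<Rightarrow> 'p::ab_group_add \<Rightarrow> 'p) \<Rightarrow> ('p \<Rightarrow> int extended) \<Rightarrow> bool"
  where "finite_filtration scale u \<longleftrightarrow> (\<forall>t. fin_dim scale (filtration u t))"

definition discrete_filtration :: "('p::zero \<Rightarrow> int extended) \<Rightarrow> bool"
  where "discrete_filtration u \<longleftrightarrow> (\<forall>t<0. filtration u t = {0})"


section \<open>The set of elements on which a linear map acts locally finitely\<close>

definition poly_orbit ::
  "('k::field \<Rightarrow> 'v::ab_group_add \<Rightarrow> 'v) \<Rightarrow> ('v \<Rightarrow> 'v) \<Rightarrow> 'v \<Rightarrow> 'v set"
  where "poly_orbit scale d x = {\<Sum>i\<le>degree p. scale (coeff p i) ((d ^^ i) x) | p. True}"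

text \<open>The set \<open>P\<close> is the carrier of the algebra: \<open>UNIV\<close> for an algebra that is
  a whole type, and \<open>tensor_space\<close> below for a tensor product.\<close>

definition ad_finite ::
  "('k::field \<Rightarrow> 'v::ab_group_add \<Rightarrow> 'v) \<Rightarrow> 'v set \<Rightarrow> ('v \<Rightarrow> 'v \<Rightarrow> 'v) \<Rightarrow> 'v \<Rightarrow> 'v set"
  where "ad_finite scale P bracket z = {x \<in> P. fin_dim scale (poly_orbit scale (bracket z) x)}"


section \<open>Tensor products\<close>

text \<open>The tensor product of two vector spaces is modelled inside the dual of the space of bilinear
  forms: \<open>x \<otimes> y\<close> is evaluation at \<open>(x, y)\<close>, and the tensor product is the
  span of these evaluations. The universal property is \<open>tensor_universal\<close> below.
  Functionals are set to \<open>0\<close> on functions that are not bilinear, so that equal tensors are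
  equal functions.\<close>

type_synonym ('k, 'a, 'b) tensor = "('a \<Rightarrow> 'b \<Rightarrow> 'k) \<Rightarrow> 'k"

abbreviation bilinear_form ::
  "('k::field \<Rightarrow> 'a::ab_group_add \<Rightarrow> 'a) \<Rightarrow> ('k \<Rightarrow> 'b::ab_group_add \<Rightarrow> 'b) \<Rightarrow> ('a \<Rightarrow> 'b \<Rightarrow> 'k) \<Rightarrow> bool"
  where "bilinear_form s1 s2 \<equiv> bilinear_map s1 s2 (*)"

definition tensor_scale :: "'k::field \<Rightarrow> ('k, 'a, 'b) tensor \<Rightarrow> ('k, 'a, 'b) tensor"
  where "tensor_scale c t = (\<lambda>f. c * t f)"

definition pure_tensor ::
  "('k::field \<Rightarrow> 'a::ab_group_add \<Rightarrow> 'a) \<Rightarrow> ('k \<Rightarrow> 'b::ab_group_add \<Rightarrow> 'b) \<Rightarrow>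
   'a \<Rightarrow> 'b \<Rightarrow> ('k, 'a, 'b) tensor"
  where "pure_tensor s1 s2 x y = (\<lambda>f. if bilinear_form s1 s2 f then f x y else 0)"

text \<open>For subspaces \<open>A\<close> and \<open>B\<close>, the subspace \<open>A \<otimes> B\<close> of the
  tensor product.\<close>

definition tensor_of ::
  "('k::field \<Rightarrow> 'a::ab_group_add \<Rightarrow> 'a) \<Rightarrow> ('k \<Rightarrow> 'b::ab_group_add \<Rightarrow> 'b) \<Rightarrow>
   'a set \<Rightarrow> 'b set \<Rightarrow> ('k, 'a, 'b) tensor set"
  where "tensor_of s1 s2 A B =
    module.span tensor_scale {pure_tensor s1 s2 x y | x y. x \<in> A \<and> y \<in> B}"

definition tensor_space ::
  "('k::field \<Rightarrow> 'a::ab_group_add \<Rightarrow> 'a) \<Rightarrow> ('k \<Rightarrow> 'b::ab_group_add \<Rightarrow> 'b) \<Rightarrow>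
   ('k, 'a, 'b) tensor set"
  where "tensor_space s1 s2 = tensor_of s1 s2 UNIV UNIV"

text \<open>The tensor product of two bilinear operations \<open>m1\<close> and \<open>m2\<close>, that is, the
  bilinear extension of \<open>(a1 \<otimes> a2, b1 \<otimes> b2) \<mapsto> m1 a1 b1 \<otimes> m2 a2 b2\<close>;
  see \<open>tensor_op_pure\<close> and \<open>tensor_op_bilinear\<close> below.\<close>

definition tensor_op ::
  "('k::field \<Rightarrow> 'a::ab_group_add \<Rightarrow> 'a) \<Rightarrow> ('k \<Rightarrow> 'b::ab_group_add \<Rightarrow> 'b) \<Rightarrow>
   ('a \<Rightarrow> 'a \<Rightarrow> 'a) \<Rightarrow> ('b \<Rightarrow> 'b \<Rightarrow> 'b) \<Rightarrow>
   ('k, 'a, 'b) tensor \<Rightarrow> ('k, 'a, 'b) tensor \<Rightarrow> ('k, 'a, 'b) tensor"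
  where "tensor_op s1 s2 m1 m2 v w =
    (\<lambda>f. if bilinear_form s1 s2 f
         then v (\<lambda>a1 a2. w (\<lambda>b1 b2. f (m1 a1 b1) (m2 a2 b2))) else 0)"

definition tensor_mult ::
  "('k::field \<Rightarrow> 'a::{ring, monoid_mult} \<Rightarrow> 'a) \<Rightarrow> ('k \<Rightarrow> 'b::{ring, monoid_mult} \<Rightarrow> 'b) \<Rightarrow>
   ('k, 'a, 'b) tensor \<Rightarrow> ('k, 'a, 'b) tensor \<Rightarrow> ('k, 'a, 'b) tensor"
  where "tensor_mult s1 s2 = tensor_op s1 s2 (*) (*)"

text \<open>Only used when both factors are of class 1 or both are of class 2.\<close>

definition tensor_bracket ::
  "('k::field \<Rightarrow> 'a::{ring, monoid_mult} \<Rightarrow> 'a) \<Rightarrow> ('k \<Rightarrow> 'b::{ring, monoid_mult} \<Rightarrow> 'b) \<Rightarrow>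
   ('a \<Rightarrow> 'a \<Rightarrow> 'a) \<Rightarrow> ('b \<Rightarrow> 'b \<Rightarrow> 'b) \<Rightarrow>
   ('k, 'a, 'b) tensor \<Rightarrow> ('k, 'a, 'b) tensor \<Rightarrow> ('k, 'a, 'b) tensor"
  where "tensor_bracket s1 s2 br1 br2 v w =
    (if class_1 br1 \<and> class_1 br2
     then tensor_op s1 s2 br1 (*) v w + tensor_op s1 s2 (\<lambda>a b. b * a) br2 v w
     else tensor_mult s1 s2 v w - tensor_mult s1 s2 w v)"


section \<open>Correctness of the tensor product construction\<close>

lemma vector_space_tensor: "vector_space (tensor_scale :: 'k::field \<Rightarrow> ('k, 'a, 'b) tensor \<Rightarrow> _)"
  by unfold_locales (auto simp: tensor_scale_def fun_eq_iff algebra_simps)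

lemma bilinear_map_iff:
  assumes "vector_space s1" "vector_space s2" "vector_space s3"
  shows "bilinear_map s1 s2 s3 f \<longleftrightarrow>
    (\<forall>x x' y. f (x + x') y = f x y + f x' y) \<and> (\<forall>c x y. f (s1 c x) y = s3 c (f x y)) \<and>
    (\<forall>x y y'. f x (y + y') = f x y + f x y') \<and> (\<forall>c x y. f x (s2 c y) = s3 c (f x y))"
proof -
  have lin: "Vector_Spaces.linear s s3 g \<longleftrightarrow>
      (\<forall>x y. g (x + y) = g x + g y) \<and> (\<forall>c x. g (s c x) = s3 c (g x))"
    if "vector_space s" for s :: "'a \<Rightarrow> 'e::ab_group_add \<Rightarrow> 'e" and g
    using that assms(3)
    by (auto simp: Vector_Spaces.linear_def module_hom_def module_hom_axioms_def
        module_iff_vector_space)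
  show ?thesis
    unfolding bilinear_map_def lin[OF assms(1)] lin[OF assms(2)] by blast
qed

lemma vector_space_mult: "vector_space ((*) :: 'k::field \<Rightarrow> 'k \<Rightarrow> 'k)"
  by unfold_locales (auto simp: algebra_simps)

lemma bilinear_map_vs:
  assumes "bilinear_map s1 s2 s3 f"
  shows "vector_space s1" "vector_space s2" "vector_space s3"
  using assms by (auto simp: bilinear_map_def Vector_Spaces.linear_def)

context
  fixes s1 :: "'k::field \<Rightarrow> 'a::ab_group_add \<Rightarrow> 'a" and s2 :: "'k \<Rightarrow> 'b::ab_group_add \<Rightarrow> 'b"
  assumes vs: "vector_space s1" "vector_space s2"
begin

interpretation T: vector_space "tensor_scale :: 'k \<Rightarrow> ('k, 'a, 'b) tensor \<Rightarrow> _"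
  by (rule vector_space_tensor)

lemmas form_iff = bilinear_map_iff[OF vs vector_space_mult]

lemma pure_tensor_bilinear: "bilinear_map s1 s2 tensor_scale (pure_tensor s1 s2)"
  unfolding bilinear_map_iff[OF vs vector_space_tensor]
  by (auto simp: pure_tensor_def tensor_scale_def fun_eq_iff form_iff)

lemma pure_in_tensor_space: "pure_tensor s1 s2 x y \<in> tensor_space s1 s2"
  unfolding tensor_space_def tensor_of_def by (rule T.span_base) auto

lemma tensor_induct [consumes 1, case_names zero add]:
  assumes "v \<in> tensor_space s1 s2" "P 0"
    and "\<And>c x y v. v \<in> tensor_space s1 s2 \<Longrightarrow> P v \<Longrightarrow> P (tensor_scale c (pure_tensor s1 s2 x y) + v)"
  shows "P v"
proof -
  have "v \<in> tensor_space s1 s2 \<and> P v"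
    using assms(1) unfolding tensor_space_def tensor_of_def
  proof (induction rule: T.span_induct_alt)
    case base
    show ?case by (rule conjI[OF T.span_zero assms(2)])
  next
    case (step c x y)
    have "tensor_scale c x + y \<in> T.span {pure_tensor s1 s2 x y | x y. x \<in> UNIV \<and> y \<in> UNIV}"
      using step by (blast intro: T.span_add T.span_scale T.span_base)
    moreover have "P (tensor_scale c x + y)"
      using step assms(3)[of y c] unfolding tensor_space_def tensor_of_def by blast
    ultimately show ?case ..
  qed
  then show ?thesis ..
qed

theorem tensor_universal:
  assumes g: "bilinear_map s1 s2 s3 g"
  shows "\<exists>h. Vector_Spaces.linear tensor_scale s3 h \<and> (\<forall>x y. h (pure_tensor s1 s2 x y) = g x y)"
    and "\<lbrakk>Vector_Spaces.linear tensor_scale s3 h; \<forall>x y. h (pure_tensor s1 s2 x y) = g x y;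
          Vector_Spaces.linear tensor_scale s3 h'; \<forall>x y. h' (pure_tensor s1 s2 x y) = g x y;
          v \<in> tensor_space s1 s2\<rbrakk> \<Longrightarrow> h v = h' v"
proof -
  have vs3: "vector_space s3" using bilinear_map_vs[OF g] by simp
  interpret W: vector_space s3 by (rule vs3)
  interpret TW: vector_space_pair "tensor_scale :: 'k \<Rightarrow> ('k, 'a, 'b) tensor \<Rightarrow> _" s3 ..
  interpret K: vector_space "(*) :: 'k \<Rightarrow> 'k \<Rightarrow> 'k" by (rule vector_space_mult)
  interpret WK: vector_space_pair s3 "(*) :: 'k \<Rightarrow> 'k \<Rightarrow> 'k" ..
  note lin_simps = Vector_Spaces.linear_def module_hom_def module_hom_axioms_def
  have gb: "g (x + x') y = g x y + g x' y" "g (s1 c x) y = s3 c (g x y)"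
    "g x (y + y') = g x y + g x y'" "g x (s2 c y) = s3 c (g x y)" for x x' y y' c
    using g unfolding bilinear_map_iff[OF vs vs3] by auto
  let ?S = "{pure_tensor s1 s2 x y | x y. x \<in> UNIV \<and> y \<in> UNIV}"
  obtain B where B: "B \<subseteq> ?S" "T.independent B" "?S \<subseteq> T.span B"
    by (rule T.maximal_independent_subset[of ?S])
  have "\<forall>b\<in>B. \<exists>xy. b = pure_tensor s1 s2 (fst xy) (snd xy)"
    using B(1) by auto
  then obtain r where r: "\<And>b. b \<in> B \<Longrightarrow> b = pure_tensor s1 s2 (fst (r b)) (snd (r b))"
    by metis
  obtain h where h: "Vector_Spaces.linear tensor_scale s3 h"
      "\<And>b. b \<in> B \<Longrightarrow> h b = g (fst (r b)) (snd (r b))"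
    using TW.linear_independent_extend[OF B(2), of "\<lambda>b. g (fst (r b)) (snd (r b))"] by auto
  have hl: "h (v + w) = h v + h w" "h (tensor_scale c v) = s3 c (h v)" for v w c
    using h(1) by (auto simp: lin_simps)
  have h0: "h 0 = 0" using hl(1)[of 0 0] by simp
  have "h (pure_tensor s1 s2 x y) = g x y" for x y
  proof (rule ccontr)
    assume ne: "h (pure_tensor s1 s2 x y) \<noteq> g x y"
    define d where "d = h (pure_tensor s1 s2 x y) - g x y"
    have ind: "W.independent {d}" using ne by (simp add: d_def W.dependent_single)
    obtain p where p: "Vector_Spaces.linear s3 (*) p" "p d = (1::'k)"
      using WK.linear_independent_extend[OF ind, of "\<lambda>_. 1"] by auto
    have pl: "p (v + w) = p v + p w" "p (s3 c v) = c * p v" for v w c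
      using p(1) by (auto simp: lin_simps)
    have p0: "p 0 = 0" using pl(2)[of 0 0] by simp
    have form: "bilinear_form s1 s2 (\<lambda>x y. p (g x y))"
      unfolding form_iff by (auto simp: gb pl)
    have "p (h v) = v (\<lambda>x y. p (g x y))" if "v \<in> T.span B" for v
      using that
    proof (induction rule: T.span_induct_alt)
      case base
      show ?case unfolding h0 p0 by simp
    next
      case (step c b v)
      have "p (h b) = b (\<lambda>x y. p (g x y))"
        using r[OF step(1)] h(2)[OF step(1)] form by (metis pure_tensor_def)
      then show ?case unfolding hl pl using step by (simp add: tensor_scale_def)
    qed
    moreover have "pure_tensor s1 s2 x y \<in> T.span B" using B(3) by auto
    ultimately have "p (h (pure_tensor s1 s2 x y)) = p (g x y)"
      using form by (simp add: pure_tensor_def)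
    moreover have "p (h (pure_tensor s1 s2 x y)) = p d + p (g x y)"
      by (simp add: d_def flip: pl(1))
    ultimately show False using p(2) by simp
  qed
  then show "\<exists>h. Vector_Spaces.linear tensor_scale s3 h \<and> (\<forall>x y. h (pure_tensor s1 s2 x y) = g x y)"
    using h(1) by blast
  show "h v = h' v" if "Vector_Spaces.linear tensor_scale s3 h"
    "\<forall>x y. h (pure_tensor s1 s2 x y) = g x y" "Vector_Spaces.linear tensor_scale s3 h'"
    "\<forall>x y. h' (pure_tensor s1 s2 x y) = g x y" "v \<in> tensor_space s1 s2" for h h'
  proof (rule TW.linear_eq_on[OF that(1,3)])
    show "v \<in> T.span ?S" using that(5) unfolding tensor_space_def tensor_of_def .
    show "h b = h' b" if "b \<in> ?S" for b
      using that \<open>\<forall>x y. h _ = _\<close> \<open>\<forall>x y. h' _ = _\<close> by auto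
  qed
qed

lemma tensor_zero_off: "v \<in> tensor_space s1 s2 \<Longrightarrow> \<not> bilinear_form s1 s2 f \<Longrightarrow> v f = 0"
  by (induction rule: tensor_induct) (auto simp: tensor_scale_def pure_tensor_def)

lemma tensor_linear_form:
  assumes "v \<in> tensor_space s1 s2" "bilinear_form s1 s2 f" "bilinear_form s1 s2 g"
  shows "v (\<lambda>x y. f x y + g x y) = v f + v g" and "v (\<lambda>x y. c * f x y) = c * v f"
proof -
  have fg: "bilinear_form s1 s2 (\<lambda>x y. f x y + g x y)" "bilinear_form s1 s2 (\<lambda>x y. c * f x y)"
    using assms(2,3) unfolding form_iff by (auto simp: algebra_simps)
  show "v (\<lambda>x y. f x y + g x y) = v f + v g" "v (\<lambda>x y. c * f x y) = c * v f"
    using assms(1)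
    by (induction rule: tensor_induct)
      (simp_all add: assms fg tensor_scale_def pure_tensor_def algebra_simps)
qed

context
  fixes m1 :: "'a \<Rightarrow> 'a \<Rightarrow> 'a" and m2 :: "'b \<Rightarrow> 'b \<Rightarrow> 'b"
  assumes m1: "bilinear_map s1 s1 s1 m1" and m2: "bilinear_map s2 s2 s2 m2"
begin

lemmas m1' = m1[unfolded bilinear_map_iff[OF vs(1) vs(1) vs(1)]]
lemmas m2' = m2[unfolded bilinear_map_iff[OF vs(2) vs(2) vs(2)]]

lemma op_form_right:
  assumes "bilinear_form s1 s2 f"
  shows "bilinear_form s1 s2 (\<lambda>b1 b2. f (m1 a1 b1) (m2 a2 b2))"
  using assms m1' m2' unfolding form_iff by simp

lemma op_form_left:
  assumes f: "bilinear_form s1 s2 f" and w: "w \<in> tensor_space s1 s2"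
  shows "bilinear_form s1 s2 (\<lambda>a1 a2. w (\<lambda>b1 b2. f (m1 a1 b1) (m2 a2 b2)))"
proof -
  note fb = f[unfolded form_iff]
  show ?thesis
    unfolding form_iff
    using m1' m2' fb tensor_linear_form[OF w op_form_right[OF f] op_form_right[OF f]] by simp
qed

theorem tensor_op_pure:
  "tensor_op s1 s2 m1 m2 (pure_tensor s1 s2 a1 a2) (pure_tensor s1 s2 b1 b2) =
   pure_tensor s1 s2 (m1 a1 b1) (m2 a2 b2)"
proof
  fix f
  show "tensor_op s1 s2 m1 m2 (pure_tensor s1 s2 a1 a2) (pure_tensor s1 s2 b1 b2) f =
    pure_tensor s1 s2 (m1 a1 b1) (m2 a2 b2) f"
    using op_form_left[OF _ pure_in_tensor_space[of b1 b2], of f] op_form_right[of f]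
    by (auto simp: tensor_op_def pure_tensor_def)
qed

theorem tensor_op_bilinear:
  assumes "v \<in> tensor_space s1 s2" "v' \<in> tensor_space s1 s2"
    "w \<in> tensor_space s1 s2" "w' \<in> tensor_space s1 s2"
  shows "tensor_op s1 s2 m1 m2 (v + v') w = tensor_op s1 s2 m1 m2 v w + tensor_op s1 s2 m1 m2 v' w"
    "tensor_op s1 s2 m1 m2 v (w + w') = tensor_op s1 s2 m1 m2 v w + tensor_op s1 s2 m1 m2 v w'"
    "tensor_op s1 s2 m1 m2 (tensor_scale c v) w = tensor_scale c (tensor_op s1 s2 m1 m2 v w)"
    "tensor_op s1 s2 m1 m2 v (tensor_scale c w) = tensor_scale c (tensor_op s1 s2 m1 m2 v w)"
  using tensor_linear_form[OF assms(1) op_form_left op_form_left] assms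
  by (auto simp: tensor_op_def tensor_scale_def fun_eq_iff)

theorem tensor_op_closed:
  assumes v: "v \<in> tensor_space s1 s2" and w: "w \<in> tensor_space s1 s2"
  shows "tensor_op s1 s2 m1 m2 v w \<in> tensor_space s1 s2"
proof -
  have sub: "T.subspace (tensor_space s1 s2)"
    unfolding tensor_space_def tensor_of_def by (rule T.subspace_span)
  have zero0: "0 \<in> tensor_space s1 s2" by (rule T.subspace_0[OF sub])
  have pure: "tensor_op s1 s2 m1 m2 (pure_tensor s1 s2 x y) w \<in> tensor_space s1 s2" for x y
    using w
  proof (induction rule: tensor_induct)
    case zero
    have "tensor_op s1 s2 m1 m2 (pure_tensor s1 s2 x y) (tensor_scale 0 0) =
        tensor_scale 0 (tensor_op s1 s2 m1 m2 (pure_tensor s1 s2 x y) 0)"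
      by (rule tensor_op_bilinear(4)[OF pure_in_tensor_space zero0 zero0 zero0])
    then show ?case using zero0 by (simp only: T.scale_zero_left)
  next
    case (add c x' y' w)
    let ?p = "pure_tensor s1 s2 x y" and ?q = "pure_tensor s1 s2 x' y'"
    have q: "tensor_scale c ?q \<in> tensor_space s1 s2"
      by (intro T.subspace_scale[OF sub] pure_in_tensor_space)
    have "tensor_op s1 s2 m1 m2 ?p (tensor_scale c ?q + w) =
        tensor_op s1 s2 m1 m2 ?p (tensor_scale c ?q) + tensor_op s1 s2 m1 m2 ?p w"
      by (rule tensor_op_bilinear(2)[OF pure_in_tensor_space zero0 q add.hyps])
    also have "tensor_op s1 s2 m1 m2 ?p (tensor_scale c ?q) =
        tensor_scale c (tensor_op s1 s2 m1 m2 ?p ?q)"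
      by (rule tensor_op_bilinear(4)[OF pure_in_tensor_space zero0 pure_in_tensor_space zero0])
    finally show ?case
      unfolding tensor_op_pure
      by (simp only: T.subspace_add[OF sub] T.subspace_scale[OF sub] pure_in_tensor_space add.IH)
  qed
  show ?thesis
    using v
  proof (induction rule: tensor_induct)
    case zero
    have "tensor_op s1 s2 m1 m2 (tensor_scale 0 0) w =
        tensor_scale 0 (tensor_op s1 s2 m1 m2 0 w)"
      by (rule tensor_op_bilinear(3)[OF zero0 zero0 w zero0])
    then show ?case using zero0 by (simp only: T.scale_zero_left)
  next
    case (add c x y v)
    let ?q = "pure_tensor s1 s2 x y"
    have q: "tensor_scale c ?q \<in> tensor_space s1 s2"
      by (intro T.subspace_scale[OF sub] pure_in_tensor_space)
    have "tensor_op s1 s2 m1 m2 (tensor_scale c ?q + v) w =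
        tensor_op s1 s2 m1 m2 (tensor_scale c ?q) w + tensor_op s1 s2 m1 m2 v w"
      by (rule tensor_op_bilinear(1)[OF q add.hyps w zero0])
    also have "tensor_op s1 s2 m1 m2 (tensor_scale c ?q) w =
        tensor_scale c (tensor_op s1 s2 m1 m2 ?q w)"
      by (rule tensor_op_bilinear(3)[OF pure_in_tensor_space zero0 w zero0])
    finally show ?case
      by (simp only: T.subspace_add[OF sub] T.subspace_scale[OF sub] pure add.IH)
  qed
qed

end

end

theorem tensor_mult_pure:
  assumes "nc_poisson_algebra s1 br1" "nc_poisson_algebra s2 br2"
  shows "tensor_mult s1 s2 (pure_tensor s1 s2 a1 a2) (pure_tensor s1 s2 b1 b2) =
    pure_tensor s1 s2 (a1 * b1) (a2 * b2)"
  using assms unfolding tensor_mult_def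
  by (intro tensor_op_pure)
    (auto simp: nc_poisson_algebra_def nc_poisson_algebra_axioms_def)

theorem tensor_bracket_pure:
  assumes P: "nc_poisson_algebra s1 br1" "nc_poisson_algebra s2 br2"
    and "class_1 br1" "class_1 br2"
  shows "tensor_bracket s1 s2 br1 br2 (pure_tensor s1 s2 a1 a2) (pure_tensor s1 s2 b1 b2) =
    pure_tensor s1 s2 (br1 a1 b1) (a2 * b2) + pure_tensor s1 s2 (b1 * a1) (br2 a2 b2)"
proof -
  have vs: "vector_space s1" "vector_space s2"
    and m: "bilinear_map s1 s1 s1 (*)" "bilinear_map s2 s2 s2 (*)"
    and br: "bilinear_map s1 s1 s1 br1" "bilinear_map s2 s2 s2 br2"
    using P by (auto simp: nc_poisson_algebra_def nc_poisson_algebra_axioms_def)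
  have flip: "bilinear_map s1 s1 s1 (\<lambda>a b. b * a)"
    using m(1) by (auto simp: bilinear_map_def)
  show ?thesis
    using assms(3,4) unfolding tensor_bracket_def
    by (simp only: simp_thms if_True tensor_op_pure[OF vs br(1) m(2)]
        tensor_op_pure[OF vs flip br(2)])
qed

end

theory Submission
  imports Defs
begin

text \<open>The adjoint map of \<open>z1 \<otimes> 1 + 1 \<otimes> z2\<close>
  is \<open>D = d1 \<otimes> 1 + 1 \<otimes> d2\<close> with \<open>di\<close> the adjoint map of \<open>zi\<close>,
  and \<open>F(z)\<close> is the torsion submodule for the action of \<open>K[t]\<close> through the adjoint
  map of \<open>z\<close>. Let \<open>x = \<Sum> a\<^sub>b \<otimes> b\<close> be killed by \<open>p(D)\<close>, with
  independent \<open>b\<close>. Some \<open>q(d1)\<close> with \<open>q \<noteq> 0\<close> moves all \<open>a\<^sub>b\<close> into a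
  free \<open>K[t]\<close>-module \<open>M\<close>. On \<open>M \<otimes> P2\<close>, regarded as polynomials in
  \<open>t\<close> with vector coefficients, \<open>D\<close> is \<open>t\<close> plus a term of degree \<open>0\<close>, so it
  raises degrees by one and \<open>p(D)\<close> is injective. Hence \<open>q(d1) a\<^sub>b = 0\<close> for all
  \<open>b\<close>; exchanging the factors finishes the argument.\<close>

section \<open>Polynomials acting through a linear map\<close>

text \<open>The formula is the one in \<open>poly_orbit\<close>, so that an orbit is the set of all
  values \<open>p(d) x\<close>.\<close>

definition poly_action ::
  "('k::field \<Rightarrow> 'v::ab_group_add \<Rightarrow> 'v) \<Rightarrow> ('v \<Rightarrow> 'v) \<Rightarrow> 'k poly \<Rightarrow> 'v \<Rightarrow> 'v"
  where "poly_action scale d p x = (\<Sum>i\<le>degree p. scale (coeff p i) ((d ^^ i) x))"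

definition torsion :: "('k::field \<Rightarrow> 'v::ab_group_add \<Rightarrow> 'v) \<Rightarrow> ('v \<Rightarrow> 'v) \<Rightarrow> 'v set"
  where "torsion scale d = {x. \<exists>p. p \<noteq> 0 \<and> poly_action scale d p x = 0}"

lemma linear_iff_add_scale:
  "Vector_Spaces.linear s s' g \<longleftrightarrow> vector_space s \<and> vector_space s' \<and>
     (\<forall>x y. g (x + y) = g x + g y) \<and> (\<forall>c x. g (s c x) = s' c (g x))"
  by (auto simp: Vector_Spaces.linear_def module_hom_def module_hom_axioms_def
      module_iff_vector_space)

locale linear_endo = vector_space scale
  for scale :: "'k::field \<Rightarrow> 'v::ab_group_add \<Rightarrow> 'v" +
  fixes d :: "'v \<Rightarrow> 'v"
  assumes d_add: "d (x + y) = d x + d y"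
    and d_scale: "d (scale c x) = scale c (d x)"
begin

lemma d_zero: "d 0 = 0"
  using d_scale[of 0 0] by simp

lemma d_sum: "d (sum f A) = (\<Sum>x\<in>A. d (f x))"
  by (induction A rule: infinite_finite_induct) (simp_all add: d_zero d_add)

lemma funpow_add: "(d ^^ n) (x + y) = (d ^^ n) x + (d ^^ n) y"
  by (induction n) (simp_all add: d_add)

lemma funpow_scale: "(d ^^ n) (scale c x) = scale c ((d ^^ n) x)"
  by (induction n) (simp_all add: d_scale)

text \<open>Padding with zero coefficients lets sums belonging to different polynomials run over one
  index range.\<close>

lemma poly_action_bound:
  assumes "degree p \<le> n"
  shows "poly_action scale d p x = (\<Sum>i\<le>n. scale (coeff p i) ((d ^^ i) x))"
  unfolding poly_action_def
  by (rule sum.mono_neutral_left) (use assms in \<open>auto simp: coeff_eq_0\<close>)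

lemma poly_action_0: "poly_action scale d 0 x = 0"
  by (simp add: poly_action_def)

lemma poly_action_1: "poly_action scale d 1 x = x"
  by (simp add: poly_action_def)

lemma poly_action_add_poly:
  "poly_action scale d (p + q) x = poly_action scale d p x + poly_action scale d q x"
proof -
  let ?n = "max (degree p) (degree q)"
  have "degree (p + q) \<le> ?n" by (rule degree_add_le_max)
  then show ?thesis
    using poly_action_bound[of p ?n] poly_action_bound[of q ?n] poly_action_bound[of "p + q" ?n]
    by (simp add: scale_left_distrib sum.distrib)
qed

lemma poly_action_smult: "poly_action scale d (smult c p) x = scale c (poly_action scale d p x)"
  using poly_action_bound[of "smult c p" "degree p"] degree_smult_le[of c p]
  by (simp add: poly_action_def scale_sum_right)

lemma poly_action_monom: "poly_action scale d (monom c n) x = scale c ((d ^^ n) x)"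
proof -
  have "poly_action scale d (monom c n) x = (\<Sum>i\<le>n. scale (coeff (monom c n) i) ((d ^^ i) x))"
    by (rule poly_action_bound) (rule degree_monom_le)
  also have "\<dots> = (\<Sum>i\<le>n. if i = n then scale c ((d ^^ n) x) else 0)"
    by (rule sum.cong) auto
  finally show ?thesis by simp
qed

lemma poly_action_sum_poly:
  "poly_action scale d (\<Sum>j\<in>J. p j) x = (\<Sum>j\<in>J. poly_action scale d (p j) x)"
  by (induction J rule: infinite_finite_induct) (simp_all add: poly_action_0 poly_action_add_poly)

lemma poly_action_add: "poly_action scale d p (x + y) = poly_action scale d p x + poly_action scale d p y"
  by (simp add: poly_action_def funpow_add scale_right_distrib sum.distrib)

lemma poly_action_scale: "poly_action scale d p (scale c x) = scale c (poly_action scale d p x)"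
  by (simp add: poly_action_def funpow_scale scale_sum_right mult.commute)

lemma linear_poly_action: "Vector_Spaces.linear scale scale (poly_action scale d p)"
  using vector_space_axioms by (simp add: linear_iff_add_scale poly_action_add poly_action_scale)

lemma poly_action_zero: "poly_action scale d p 0 = 0"
  using poly_action_scale[of p 0 0] by simp

lemma poly_action_sum: "poly_action scale d p (\<Sum>j\<in>J. f j) = (\<Sum>j\<in>J. poly_action scale d p (f j))"
  by (induction J rule: infinite_finite_induct) (simp_all add: poly_action_zero poly_action_add)

text \<open>Since \<open>pCons 0 p\<close> is \<open>t * p\<close>, this says that the variable
  \<open>t\<close> acts as \<open>d\<close>.\<close>

lemma d_poly_action: "d (poly_action scale d p x) = poly_action scale d (pCons 0 p) x"
proof -
  have "poly_action scale d (pCons 0 p) x =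
      (\<Sum>i\<le>Suc (degree p). scale (coeff (pCons 0 p) i) ((d ^^ i) x))"
    by (rule poly_action_bound) (rule degree_pCons_le)
  also have "\<dots> = (\<Sum>i\<le>degree p. scale (coeff p i) ((d ^^ Suc i) x))"
    by (subst sum.atMost_Suc_shift) simp
  also have "\<dots> = d (poly_action scale d p x)"
    by (simp add: poly_action_def d_sum d_scale)
  finally show ?thesis ..
qed

text \<open>This makes the space a K[t]-module. The induction follows Horner's scheme:
  \<open>pCons a p\<close> is \<open>a + t * p\<close>.\<close>

lemma poly_action_mult:
  "poly_action scale d (p * q) x = poly_action scale d p (poly_action scale d q x)"
proof (induction p)
  case 0
  show ?case by (simp add: poly_action_0)
next
  case (pCons a p)
  have "pCons a p = smult a 1 + pCons 0 p" by simp
  then have "poly_action scale d (pCons a p) y = scale a y + d (poly_action scale d p y)" for y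
    by (metis poly_action_add_poly poly_action_smult poly_action_1 d_poly_action)
  then show ?case
    by (simp add: mult_pCons_left poly_action_add_poly poly_action_smult pCons.IH
        flip: d_poly_action)
qed

section \<open>Finite-dimensional orbits and torsion\<close>

lemma poly_orbit_eq_range: "poly_orbit scale d x = range (\<lambda>p. poly_action scale d p x)"
  unfolding poly_orbit_def poly_action_def by auto

lemma subspace_poly_orbit: "subspace (poly_orbit scale d x)"
  unfolding poly_orbit_eq_range subspace_def
  by (auto simp: image_iff) (metis poly_action_0 poly_action_add_poly poly_action_smult)+

text \<open>Division with remainder by an annihilating \<open>p\<close> reduces every
  \<open>q(d) x\<close> to a combination of the first \<open>degree p\<close> iterates of
  \<open>x\<close>.\<close>

lemma torsion_imp_fin_dim:
  assumes "x \<in> torsion scale d"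
  shows "fin_dim scale (poly_orbit scale d x)"
proof -
  obtain p where p: "p \<noteq> 0" "poly_action scale d p x = 0"
    using assms by (auto simp: torsion_def)
  let ?B = "(\<lambda>i. (d ^^ i) x) ` {..<degree p}"
  have "poly_action scale d q x \<in> span ?B" for q
  proof -
    have "poly_action scale d q x = poly_action scale d ((q div p) * p + q mod p) x" by simp
    also have "\<dots> = poly_action scale d (q mod p) x"
      by (simp only: poly_action_add_poly poly_action_mult p poly_action_zero add_0_left)
    also have "\<dots> \<in> span ?B"
    \<comment> \<open>A zero remainder is treated apart: its degree is 0, which is not below
      \<open>degree p\<close> when \<open>p\<close> is constant.\<close>
    proof (cases "q mod p = 0")
      case True
      then show ?thesis by (simp add: poly_action_0 span_zero)
    next
      case False
      then have "degree (q mod p) < degree p"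
        using p(1) degree_mod_less' by blast
      then show ?thesis
        unfolding poly_action_def
        by (intro span_sum span_scale span_base) auto
    qed
    finally show ?thesis .
  qed
  moreover have "?B \<subseteq> poly_orbit scale d x"
    unfolding poly_orbit_eq_range image_iff
    by (auto intro!: exI[of _ "monom 1 _"] simp: poly_action_monom image_iff)
  ultimately have "span ?B = poly_orbit scale d x"
    using span_minimal[OF _ subspace_poly_orbit] unfolding poly_orbit_eq_range by blast
  then show ?thesis unfolding fin_dim_def by blast
qed

text \<open>Any \<open>card B + 1\<close> iterates of \<open>x\<close> in the invariant space
  spanned by \<open>B\<close> satisfy a linear relation, and its coefficients form an annihilating
  polynomial.\<close>

lemma finite_invariant_imp_torsion:
  assumes B: "finite B" and x: "x \<in> span B" and inv: "\<And>b. b \<in> B \<Longrightarrow> d b \<in> span B"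
  shows "x \<in> torsion scale d"
proof (rule ccontr)
  assume not: "x \<notin> torsion scale d"
  have closed: "d y \<in> span B" if "y \<in> span B" for y
    using that
    by (induction rule: span_induct_alt)
      (simp_all add: d_zero d_add d_scale span_zero span_add span_scale inv)
  have orb: "(d ^^ i) x \<in> span B" for i
    by (induction i) (simp_all add: x closed)
  define g where "g = (\<lambda>i. (d ^^ i) x)"
  have free: "k i = 0" if "(\<Sum>i\<le>n. scale (k i) (g i)) = 0" "i \<le> n" for k n i
  proof -
    let ?p = "\<Sum>i\<le>n. monom (k i) i"
    have "poly_action scale d ?p x = 0"
      using that(1) by (simp add: poly_action_sum_poly poly_action_monom g_def)
    then have "?p = 0" using not by (auto simp: torsion_def)
    then have "coeff ?p i = 0" by simp
    then show ?thesis using that(2) by (simp add: coeff_sum)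
  qed
  let ?n = "card B"
  \<comment> \<open>Independence concerns the set of iterates, so the count also needs them to be
    distinct. An equality \<open>g i = g j\<close> would be a relation with coefficients 1 and
    -1.\<close>
  have inj: "inj_on g {..?n}"
  proof (rule inj_onI, rule ccontr)
    fix i j assume ij: "i \<in> {..?n}" "j \<in> {..?n}" "g i = g j" "i \<noteq> j"
    let ?k = "\<lambda>l. if l = i then 1 else if l = j then - 1 else (0::'k)"
    have "(\<Sum>l\<le>?n. scale (?k l) (g l)) = (\<Sum>l\<in>{i, j}. scale (?k l) (g l))"
      by (rule sum.mono_neutral_right) (use ij in auto)
    also have "\<dots> = 0" using ij by simp
    finally show False using free[of ?k ?n i] ij by simp
  qed
  have "independent (g ` {..?n})"
  proof (rule independent_if_scalars_zero)
    fix f y assume f: "(\<Sum>x\<in>g ` {..?n}. scale (f x) x) = 0" and y: "y \<in> g ` {..?n}"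
    have "(\<Sum>i\<le>?n. scale (f (g i)) (g i)) = 0"
      using f by (simp add: sum.reindex[OF inj])
    then show "f y = 0" using free[of "\<lambda>i. f (g i)" ?n] y by auto
  qed simp
  then have "card (g ` {..?n}) \<le> ?n"
    using independent_span_bound[OF B] orb by (auto simp: g_def)
  then show False using card_image[OF inj] by simp
qed

lemma fin_dim_iff_torsion: "fin_dim scale (poly_orbit scale d x) \<longleftrightarrow> x \<in> torsion scale d"
proof
  assume "fin_dim scale (poly_orbit scale d x)"
  then obtain B where B: "finite B" "span B = poly_orbit scale d x"
    by (auto simp: fin_dim_def)
  show "x \<in> torsion scale d"
  proof (rule finite_invariant_imp_torsion[OF B(1)])
    show "x \<in> span B"
      unfolding B(2) poly_orbit_eq_range by (metis poly_action_1 rangeI)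
    show "d b \<in> span B" if "b \<in> B" for b
      using span_base[OF that] unfolding B(2) poly_orbit_eq_range
      by (auto simp: d_poly_action)
  qed
qed (rule torsion_imp_fin_dim)

text \<open>The orbit itself is the invariant subspace. One such subspace in each factor will give
  an invariant subspace of the tensor product.\<close>

lemma torsion_obtain_invariant:
  assumes "x \<in> torsion scale d"
  obtains B where "finite B" "x \<in> span B" "\<And>y. y \<in> span B \<Longrightarrow> d y \<in> span B"
proof -
  obtain B where B: "finite B" "span B = poly_orbit scale d x"
    using torsion_imp_fin_dim[OF assms] by (auto simp: fin_dim_def)
  show ?thesis
  proof (rule that[OF B(1)])
    show "x \<in> span B"
      unfolding B(2) poly_orbit_eq_range by (metis poly_action_1 rangeI)
    show "d y \<in> span B" if "y \<in> span B" for y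
      using that unfolding B(2) poly_orbit_eq_range by (auto simp: d_poly_action)
  qed
qed

text \<open>A sum is annihilated by the product of the two annihilators, which is nonzero because
  K[t] has no zero divisors.\<close>

lemma subspace_torsion: "subspace (torsion scale d)"
proof (rule subspaceI)
  show "0 \<in> torsion scale d"
    using poly_action_zero[of 1] by (auto simp: torsion_def intro!: exI[of _ 1])
  show "scale c x \<in> torsion scale d" if "x \<in> torsion scale d" for c x
    using that by (auto simp: torsion_def poly_action_scale)
  show "x + y \<in> torsion scale d" if xy: "x \<in> torsion scale d" "y \<in> torsion scale d" for x y
  proof -
    obtain p q where pq: "p \<noteq> 0" "poly_action scale d p x = 0" "q \<noteq> 0" "poly_action scale d q y = 0"
      using xy by (auto simp: torsion_def)
    have "poly_action scale d (p * q) y = 0" "poly_action scale d (q * p) x = 0"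
      using pq by (simp_all only: poly_action_mult poly_action_zero)
    then have "poly_action scale d (p * q) (x + y) = 0"
      by (simp add: poly_action_add mult.commute)
    then show ?thesis using pq(1,3) by (auto simp: torsion_def intro!: exI[of _ "p * q"])
  qed
qed

text \<open>A substitute for the structure theorem of finitely generated \<open>K[t]\<close>-modules:
  \<open>E\<close> is a maximal \<open>K[t]\<close>-independent subset of \<open>A\<close>, and \<open>q\<close>
  is a common denominator.\<close>

lemma free_submodule:
  assumes "finite A"
  shows "\<exists>q E. q \<noteq> 0 \<and> finite E \<and>
    (\<forall>P. (\<Sum>e\<in>E. poly_action scale d (P e) e) = 0 \<longrightarrow> (\<forall>e\<in>E. P e = 0)) \<and>
    (\<forall>a\<in>A. \<exists>P. poly_action scale d q a = (\<Sum>e\<in>E. poly_action scale d (P e) e))"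
  using assms
proof (induction A)
  case empty
  show ?case by (intro exI[of _ 1] exI[of _ "{}"]) simp
next
  case (insert a A)
  then obtain q E where q: "q \<noteq> 0" and E: "finite E"
    and free: "\<forall>P. (\<Sum>e\<in>E. poly_action scale d (P e) e) = 0 \<longrightarrow> (\<forall>e\<in>E. P e = 0)"
    and A: "\<forall>a\<in>A. \<exists>P. poly_action scale d q a = (\<Sum>e\<in>E. poly_action scale d (P e) e)"
    by (elim exE conjE) (rule that)
  \<comment> \<open>The denominator \<open>q\<close> may be replaced by any of its
    multiples.\<close>
  have mult: "\<exists>P. poly_action scale d (r * t) x = (\<Sum>e\<in>E. poly_action scale d (P e) e)"
    if t: "\<exists>P. poly_action scale d t x = (\<Sum>e\<in>E. poly_action scale d (P e) e)" for r t x
  proof -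
    obtain P where "poly_action scale d t x = (\<Sum>e\<in>E. poly_action scale d (P e) e)"
      using t by blast
    then have "poly_action scale d (r * t) x = (\<Sum>e\<in>E. poly_action scale d (r * P e) e)"
      by (simp add: poly_action_mult poly_action_sum)
    then show ?thesis by (intro exI[of _ "\<lambda>e. r * P e"])
  qed
  show ?case
  \<comment> \<open>If \<open>a\<close> has a nonzero multiple in the module generated by
    \<open>E\<close>, the multiplier \<open>r\<close> joins the denominator; otherwise
    \<open>a\<close> joins \<open>E\<close>.\<close>
  proof (cases "\<exists>r P. r \<noteq> 0 \<and> poly_action scale d r a = (\<Sum>e\<in>E. poly_action scale d (P e) e)")
    case True
    then obtain r where r: "r \<noteq> 0"
      "\<exists>P. poly_action scale d r a = (\<Sum>e\<in>E. poly_action scale d (P e) e)" by blast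
    have "\<exists>P. poly_action scale d (q * r) b = (\<Sum>e\<in>E. poly_action scale d (P e) e)"
      if "b \<in> insert a A" for b
      using that mult[OF r(2), of q] mult[OF bspec[OF A], of b r] by (auto simp: mult.commute)
    then show ?thesis
      using q r(1) E free by (intro exI[of _ "q * r"] exI[of _ E]) auto
  next
    case False
    have aE: "a \<notin> E"
    proof
      assume "a \<in> E"
      have "(\<Sum>e\<in>E. poly_action scale d (if e = a then 1 else 0) e) =
          (\<Sum>e\<in>E. if e = a then a else 0)"
        by (rule sum.cong) (auto simp: poly_action_0 poly_action_1)
      then have "poly_action scale d 1 a =
          (\<Sum>e\<in>E. poly_action scale d (if e = a then 1 else 0) e)"
        using \<open>a \<in> E\<close> E by (simp add: poly_action_1)
      then have "\<exists>r P. r \<noteq> 0 \<and> poly_action scale d r a = (\<Sum>e\<in>E. poly_action scale d (P e) e)"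
        by (intro exI[of _ 1] exI[of _ "\<lambda>e. if e = a then 1 else 0"] conjI one_neq_zero)
      with False show False ..
    qed
    \<comment> \<open>A nonzero coefficient at \<open>a\<close> could be isolated on one side and
      would contradict the case assumption; once it is 0, freeness of \<open>E\<close>
      applies.\<close>
    have free': "P e = 0"
      if P: "(\<Sum>e\<in>insert a E. poly_action scale d (P e) e) = 0" and e: "e \<in> insert a E" for P e
    proof -
      have s: "poly_action scale d (P a) a + (\<Sum>e\<in>E. poly_action scale d (P e) e) = 0"
        using P E aE by simp
      have neg: "poly_action scale d (- p) x = - poly_action scale d p x" for p x
        using poly_action_smult[of "- 1" p x] by simp
      have "poly_action scale d (P a) a = - (\<Sum>e\<in>E. poly_action scale d (P e) e)"
        using s by (simp add: eq_neg_iff_add_eq_0)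
      also have "\<dots> = (\<Sum>e\<in>E. poly_action scale d (- P e) e)"
        by (simp add: neg sum_negf)
      finally have "poly_action scale d (P a) a = (\<Sum>e\<in>E. poly_action scale d (- P e) e)" .
      then have "\<exists>r P. r \<noteq> 0 \<and> poly_action scale d r a = (\<Sum>e\<in>E. poly_action scale d (P e) e)"
        if "P a \<noteq> 0"
        using that by (intro exI[of _ "P a"] exI[of _ "\<lambda>e. - P e"] conjI)
      with False have "P a = 0" by (rule contrapos_np)
      then show ?thesis using s free[rule_format, of P] e by (auto simp: poly_action_0)
    qed
    have "\<exists>P. poly_action scale d q b = (\<Sum>e\<in>insert a E. poly_action scale d (P e) e)"
      if b: "b \<in> insert a A" for b
    proof (cases "b = a")
      case True
      have "(\<Sum>e\<in>E. poly_action scale d (if e = a then q else 0) e) = 0"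
        using aE by (intro sum.neutral) (auto simp: poly_action_0)
      then show ?thesis
        using True E aE by (intro exI[of _ "\<lambda>e. if e = a then q else 0"]) simp
    next
      case False
      then obtain P where P: "poly_action scale d q b = (\<Sum>e\<in>E. poly_action scale d (P e) e)"
        using A b by blast
      have "(\<Sum>e\<in>E. poly_action scale d ((P(a := 0)) e) e) = (\<Sum>e\<in>E. poly_action scale d (P e) e)"
        by (rule sum.cong) (use aE in auto)
      then show ?thesis
        using P E aE by (intro exI[of _ "P(a := 0)"]) (simp add: poly_action_0)
    qed
    then show ?thesis
      using q E free' by (intro exI[of _ q] exI[of _ "insert a E"]) auto
  qed
qed

end

text \<open>Commutation is asked for only on an invariant set \<open>S\<close>, because maps on the
  tensor side are prescribed on pure tensors and hence known only on their span.\<close>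

lemma poly_action_intertwine:
  assumes h: "Vector_Spaces.linear s s' h"
    and S: "\<And>y. y \<in> S \<Longrightarrow> f y \<in> S \<and> h (f y) = g (h y)" and x: "x \<in> S"
  shows "h (poly_action s f p x) = poly_action s' g p (h x)"
proof -
  interpret h: Vector_Spaces.linear s s' h by (rule h)
  have "(f ^^ i) x \<in> S \<and> h ((f ^^ i) x) = (g ^^ i) (h x)" for i
    by (induction i) (simp_all add: S x)
  then show ?thesis by (simp add: poly_action_def h.sum h.scale)
qed

section \<open>Polynomials with vector coefficients\<close>

text \<open>For a vector space \<open>V\<close> with an endomorphism \<open>d\<close>, this is the
  action of \<open>t \<otimes> 1 + 1 \<otimes> d\<close> on \<open>K[t] \<otimes> V\<close>.\<close>

definition poly_shift :: "('v::ab_group_add \<Rightarrow> 'v) \<Rightarrow> 'v poly \<Rightarrow> 'v poly"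
  where "poly_shift d P = pCons 0 P + map_poly d P"

context linear_endo
begin

abbreviation pscale :: "'k \<Rightarrow> 'v poly \<Rightarrow> 'v poly"
  where "pscale c \<equiv> map_poly (scale c)"

lemma coeff_pscale: "coeff (pscale c P) i = scale c (coeff P i)"
  by (simp add: coeff_map_poly)

lemma coeff_poly_shift:
  "coeff (poly_shift d P) i = (case i of 0 \<Rightarrow> 0 | Suc j \<Rightarrow> coeff P j) + d (coeff P i)"
  by (simp add: poly_shift_def coeff_map_poly d_zero coeff_pCons)

lemma linear_endo_poly_shift: "linear_endo pscale (poly_shift d)"
  by unfold_locales
    (auto simp: poly_eq_iff coeff_pscale coeff_poly_shift scale_right_distrib scale_left_distrib
      d_add d_scale split: nat.split)

text \<open>In each new top position only the shift contributes: \<open>d\<close> acts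
  coefficientwise, and the previous polynomial has coefficient 0 there.\<close>

lemma coeff_funpow_poly_shift:
  assumes "degree P \<le> m"
  shows "degree ((poly_shift d ^^ n) P) \<le> m + n \<and> coeff ((poly_shift d ^^ n) P) (m + n) = coeff P m"
proof (induction n)
  case 0
  show ?case using assms by simp
next
  case (Suc n)
  let ?R = "(poly_shift d ^^ n) P"
  have "coeff (poly_shift d ?R) i = 0" if "i > m + Suc n" for i
    using Suc that by (auto simp: coeff_poly_shift coeff_eq_0 d_zero split: nat.split)
  then have "degree (poly_shift d ?R) \<le> m + Suc n"
    by (simp add: degree_le)
  moreover have "coeff (poly_shift d ?R) (m + Suc n) = coeff P m"
    using Suc by (simp add: coeff_poly_shift coeff_eq_0 d_zero)
  ultimately show ?case by simp
qed

text \<open>\<open>poly_shift\<close> raises the degree by one and keeps the leading coefficient,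
  whatever \<open>d\<close> is.\<close>

lemma poly_shift_torsion_free:
  assumes "poly_action pscale (poly_shift d) p P = 0" "p \<noteq> 0"
  shows "P = 0"
proof -
  let ?m = "degree P" and ?n = "degree p"
  \<comment> \<open>The \<open>i\<close>-th power of the operator gives degree at most
    \<open>?m + i\<close>, so position \<open>?m + ?n\<close> sees only the leading term of
    \<open>p\<close>.\<close>
  have "scale (coeff p i) (coeff ((poly_shift d ^^ i) P) (?m + ?n)) =
      (if i = ?n then scale (lead_coeff p) (lead_coeff P) else 0)" if "i \<le> ?n" for i
    using coeff_funpow_poly_shift[of P ?m i] that by (auto simp: coeff_eq_0)
  then have "coeff (poly_action pscale (poly_shift d) p P) (?m + ?n) =
      scale (lead_coeff p) (lead_coeff P)"
    by (simp add: poly_action_def coeff_sum coeff_pscale)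
  then show ?thesis using assms by simp
qed

end

section \<open>Endomorphisms of a tensor product\<close>

text \<open>The assumptions are symmetric in the two factors, so that every result can also be used with
  the factors exchanged.\<close>

locale tensor_pairing =
  fixes s1 :: "'k::field \<Rightarrow> 'a::ab_group_add \<Rightarrow> 'a" and s2 :: "'k \<Rightarrow> 'b::ab_group_add \<Rightarrow> 'b"
    and s3 :: "'k \<Rightarrow> 'c::ab_group_add \<Rightarrow> 'c" and \<tau> :: "'a \<Rightarrow> 'b \<Rightarrow> 'c"
  assumes bilinear: "bilinear_map s1 s2 s3 \<tau>"
    and contract_1: "Vector_Spaces.linear s1 (*) \<phi> \<Longrightarrow>
      \<exists>L. Vector_Spaces.linear s3 s2 L \<and> (\<forall>a b. L (\<tau> a b) = s2 (\<phi> a) b)"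
    and contract_2: "Vector_Spaces.linear s2 (*) \<psi> \<Longrightarrow>
      \<exists>L. Vector_Spaces.linear s3 s1 L \<and> (\<forall>a b. L (\<tau> a b) = s1 (\<psi> b) a)"
    and extend_1: "Vector_Spaces.linear s1 s1 f \<Longrightarrow>
      \<exists>L. Vector_Spaces.linear s3 s3 L \<and> (\<forall>a b. L (\<tau> a b) = \<tau> (f a) b)"
    and extend_2: "Vector_Spaces.linear s2 s2 g \<Longrightarrow>
      \<exists>L. Vector_Spaces.linear s3 s3 L \<and> (\<forall>a b. L (\<tau> a b) = \<tau> a (g b))"
begin

sublocale V1: vector_space s1 by (rule bilinear_map_vs[OF bilinear])
sublocale V2: vector_space s2 by (rule bilinear_map_vs[OF bilinear])
sublocale V3: vector_space s3 by (rule bilinear_map_vs[OF bilinear])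

lemma flip: "tensor_pairing s2 s1 s3 (\<lambda>b a. \<tau> a b)"
proof
  show "bilinear_map s2 s1 s3 (\<lambda>b a. \<tau> a b)"
    using bilinear by (simp add: bilinear_map_def)
qed (use contract_1 contract_2 extend_1 extend_2 in \<open>subst all_comm, simp\<close>)+

lemma linear_left: "Vector_Spaces.linear s1 s3 (\<lambda>a. \<tau> a b)"
  and linear_right: "Vector_Spaces.linear s2 s3 (\<tau> a)"
  using bilinear by (auto simp: bilinear_map_def)

lemma tau_add_left: "\<tau> (x + y) b = \<tau> x b + \<tau> y b"
  and tau_scale_left: "\<tau> (s1 c x) b = s3 c (\<tau> x b)"
  using linear_left[of b] by (auto simp: linear_iff_add_scale)

lemma tau_add_right: "\<tau> a (x + y) = \<tau> a x + \<tau> a y"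
  and tau_scale_right: "\<tau> a (s2 c z) = s3 c (\<tau> a z)"
  using linear_right[of a] by (auto simp: linear_iff_add_scale)

lemma tau_zero_left: "\<tau> 0 b = 0"
  using tau_scale_left[of 0 0 b] by simp

lemma tau_zero_right: "\<tau> a 0 = 0"
  using tau_scale_right[of a 0 0] by simp

lemma tau_sum_left: "\<tau> (\<Sum>i\<in>I. f i) b = (\<Sum>i\<in>I. \<tau> (f i) b)"
  by (induction I rule: infinite_finite_induct) (simp_all add: tau_zero_left tau_add_left)

section \<open>Tensors with linearly independent left factors\<close>

lemma functional_nonzero:
  assumes "v \<noteq> 0"
  shows "\<exists>\<psi>. Vector_Spaces.linear s2 (*) \<psi> \<and> \<psi> v \<noteq> (0::'k)"
proof -
  interpret K: vector_space "(*) :: 'k \<Rightarrow> 'k \<Rightarrow> 'k" by (rule vector_space_mult)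
  interpret P: vector_space_pair s2 "(*) :: 'k \<Rightarrow> 'k \<Rightarrow> 'k" ..
  have "V2.independent {v}" using assms by (simp add: V2.dependent_single)
  then obtain \<psi> where "Vector_Spaces.linear s2 (*) \<psi>" "\<psi> v = (1::'k)"
    using P.linear_independent_extend[of "{v}" "\<lambda>_. 1"] by auto
  then show ?thesis by (metis zero_neq_one)
qed

text \<open>If \<open>c a\<close> were nonzero, a functional not vanishing on it would contract the
  right factors and leave a nontrivial linear relation in \<open>A\<close>.\<close>

lemma independent_tensor_zero:
  assumes A: "V1.independent A" "finite A" and zero: "(\<Sum>a\<in>A. \<tau> a (c a)) = 0" and a: "a \<in> A"
  shows "c a = 0"
proof (rule ccontr)
  assume "c a \<noteq> 0"
  then obtain \<psi> where \<psi>: "Vector_Spaces.linear s2 (*) \<psi>" "\<psi> (c a) \<noteq> 0"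
    using functional_nonzero by blast
  obtain L where L: "Vector_Spaces.linear s3 s1 L" "\<And>a b. L (\<tau> a b) = s1 (\<psi> b) a"
    using contract_2[OF \<psi>(1)] by blast
  interpret L: Vector_Spaces.linear s3 s1 L by (rule L)
  have "(\<Sum>a\<in>A. s1 (\<psi> (c a)) a) = L (\<Sum>a\<in>A. \<tau> a (c a))"
    by (simp add: L.sum L(2))
  then have "(\<Sum>a\<in>A. s1 (\<psi> (c a)) a) = 0"
    using zero L.zero by simp
  then show False using V1.independentD[OF A order.refl, of "\<lambda>a. \<psi> (c a)"] a \<psi>(2) by blast
qed

text \<open>Left factors are expanded in a basis of \<open>S\<close>, and terms with the same basis
  vector are collected. The right factors \<open>c a\<close> may be dependent or zero.\<close>

lemma span_obtain_independent:
  assumes S: "V1.subspace S" and x: "x \<in> V3.span {\<tau> a b | a b. a \<in> S}"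
  obtains A c where "finite A" "A \<subseteq> S" "V1.independent A" "x = (\<Sum>a\<in>A. \<tau> a (c a))"
proof -
  obtain B where B: "B \<subseteq> S" "V1.independent B" "S \<subseteq> V1.span B"
    by (rule V1.maximal_independent_subset[of S])
  have "\<tau> a b \<in> V3.span {\<tau> a b | a b. a \<in> B}" if "a \<in> S" for a b
  proof -
    have "a \<in> V1.span B" using B(3) that by blast
    then show ?thesis
    proof (induction rule: V1.span_induct_alt)
      case base
      show ?case by (simp add: tau_zero_left V3.span_zero)
    next
      case (step c x y)
      then show ?case
        unfolding tau_add_left tau_scale_left
        by (intro V3.span_add V3.span_scale) (auto intro: V3.span_base)
    qed
  qed
  then have "{\<tau> a b | a b. a \<in> S} \<subseteq> V3.span {\<tau> a b | a b. a \<in> B}" by blast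
  then have "x \<in> V3.span {\<tau> a b | a b. a \<in> B}"
    using x V3.span_minimal[OF _ V3.subspace_span] by blast
  then have "\<exists>A c. finite A \<and> A \<subseteq> B \<and> x = (\<Sum>a\<in>A. \<tau> a (c a))"
  proof (induction rule: V3.span_induct_alt)
    case base
    show ?case by (intro exI[of _ "{}"]) simp
  next
    case (step k t y)
    then obtain A c where A: "finite A" "A \<subseteq> B" and y: "y = (\<Sum>a\<in>A. \<tau> a (c a))" by auto
    obtain a b where t: "t = \<tau> a b" "a \<in> B" using step by auto
    \<comment> \<open>The two summands cover both \<open>a \<in> A\<close> and
      \<open>a \<notin> A\<close>. The values of \<open>c\<close> outside \<open>A\<close> are
      arbitrary and therefore cut off.\<close>
    let ?c = "\<lambda>z. (if z = a then s2 k b else 0) + (if z \<in> A then c z else 0)"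
    have "(\<Sum>z\<in>insert a A. \<tau> z (?c z)) =
        (\<Sum>z\<in>insert a A. \<tau> z (if z = a then s2 k b else 0)) +
        (\<Sum>z\<in>insert a A. \<tau> z (if z \<in> A then c z else 0))"
      by (simp only: tau_add_right sum.distrib)
    also have "(\<Sum>z\<in>insert a A. \<tau> z (if z = a then s2 k b else 0)) =
        (\<Sum>z\<in>insert a A. if z = a then \<tau> a (s2 k b) else 0)"
      by (rule sum.cong) (auto simp: tau_zero_right)
    also have "\<dots> = s3 k t"
      using A(1) by (simp add: t tau_scale_right)
    also have "(\<Sum>z\<in>insert a A. \<tau> z (if z \<in> A then c z else 0)) = y"
      unfolding y by (rule sum.mono_neutral_cong_right) (use A(1) in \<open>auto simp: tau_zero_right\<close>)
    finally have "s3 k t + y = (\<Sum>z\<in>insert a A. \<tau> z (?c z))" ..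
    moreover have "finite (insert a A)" "insert a A \<subseteq> B" using A t by auto
    ultimately show ?case by (intro exI[of _ "insert a A"] exI[of _ ?c] conjI)
  qed
  then obtain A c where "finite A" "A \<subseteq> B" "x = (\<Sum>a\<in>A. \<tau> a (c a))"
    by (elim exE conjE)
  then show ?thesis
    using that[of A c] B V1.independent_mono[OF B(2)] by blast
qed

end

section \<open>The map \<open>d1 \<otimes> 1 + 1 \<otimes> d2\<close> on a tensor product\<close>

locale tensor_derivation = tensor_pairing s1 s2 s3 \<tau>
  for s1 :: "'k::field \<Rightarrow> 'a::ab_group_add \<Rightarrow> 'a" and s2 :: "'k \<Rightarrow> 'b::ab_group_add \<Rightarrow> 'b"
    and s3 :: "'k \<Rightarrow> 'c::ab_group_add \<Rightarrow> 'c" and \<tau> :: "'a \<Rightarrow> 'b \<Rightarrow> 'c" +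
  fixes d1 :: "'a \<Rightarrow> 'a" and d2 :: "'b \<Rightarrow> 'b" and D :: "'c \<Rightarrow> 'c"
  assumes linear_d1: "Vector_Spaces.linear s1 s1 d1"
    and linear_d2: "Vector_Spaces.linear s2 s2 d2"
    and linear_D: "Vector_Spaces.linear s3 s3 D"
    and D_tau: "D (\<tau> a b) = \<tau> (d1 a) b + \<tau> a (d2 b)"
begin

sublocale E1: linear_endo s1 d1
  by unfold_locales (use linear_d1 in \<open>auto simp: linear_iff_add_scale\<close>)
sublocale E2: linear_endo s2 d2
  by unfold_locales (use linear_d2 in \<open>auto simp: linear_iff_add_scale\<close>)
sublocale E3: linear_endo s3 D
  by unfold_locales (use linear_D in \<open>auto simp: linear_iff_add_scale\<close>)

lemma flip_derivation: "tensor_derivation s2 s1 s3 (\<lambda>b a. \<tau> a b) d2 d1 D"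
  by (intro tensor_derivation.intro flip tensor_derivation_axioms.intro)
    (simp_all add: linear_d1 linear_d2 linear_D D_tau add.commute)

text \<open>Substituting \<open>d1\<close> for the variable in \<open>K[t] \<otimes> V\<close> and applying to \<open>e\<close>.\<close>

definition insert_vec :: "'a \<Rightarrow> 'b poly \<Rightarrow> 'c"
  where "insert_vec e P = (\<Sum>i\<le>degree P. \<tau> ((d1 ^^ i) e) (coeff P i))"

lemma insert_vec_bound:
  assumes "degree P \<le> n"
  shows "insert_vec e P = (\<Sum>i\<le>n. \<tau> ((d1 ^^ i) e) (coeff P i))"
  unfolding insert_vec_def
  by (rule sum.mono_neutral_left) (use assms in \<open>auto simp: coeff_eq_0 tau_zero_right\<close>)

lemma linear_insert_vec: "Vector_Spaces.linear E2.pscale s3 (insert_vec e)"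
proof -
  interpret P: linear_endo E2.pscale "poly_shift d2" by (rule E2.linear_endo_poly_shift)
  have "insert_vec e (P + Q) = insert_vec e P + insert_vec e Q" for P Q
  proof -
    let ?n = "max (degree P) (degree Q)"
    have "degree (P + Q) \<le> ?n" by (rule degree_add_le_max)
    then show ?thesis
      using insert_vec_bound[of P ?n] insert_vec_bound[of Q ?n] insert_vec_bound[of "P + Q" ?n]
      by (simp add: tau_add_right sum.distrib)
  qed
  moreover have "insert_vec e (E2.pscale c P) = s3 c (insert_vec e P)" for c P
  proof -
    have "degree (E2.pscale c P) \<le> degree P"
      by (rule degree_le) (simp add: E2.coeff_pscale coeff_eq_0)
    then show ?thesis
      using insert_vec_bound[of "E2.pscale c P" "degree P"]
      by (simp add: insert_vec_def E2.coeff_pscale tau_scale_right V3.scale_sum_right)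
  qed
  ultimately show ?thesis
    using P.vector_space_axioms V3.vector_space_axioms by (simp add: linear_iff_add_scale)
qed

text \<open>Shifting the coefficients applies \<open>d1\<close> once more on the left, and
  \<open>map_poly d2\<close> acts on the right; these are the two terms of
  \<open>D_tau\<close>.\<close>

lemma insert_vec_shift: "insert_vec e (poly_shift d2 P) = D (insert_vec e P)"
proof -
  let ?n = "degree P"
  have "degree (poly_shift d2 P) \<le> Suc ?n"
    by (rule degree_le)
      (auto simp: E2.coeff_poly_shift coeff_eq_0 E2.d_zero split: nat.split)
  then have "insert_vec e (poly_shift d2 P) =
      (\<Sum>i\<le>Suc ?n. \<tau> ((d1 ^^ i) e) (coeff (pCons 0 P) i)) +
      (\<Sum>i\<le>Suc ?n. \<tau> ((d1 ^^ i) e) (d2 (coeff P i)))"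
    by (subst insert_vec_bound)
      (simp_all only: poly_shift_def coeff_add tau_add_right sum.distrib
        coeff_map_poly E2.d_zero)
  also have "(\<Sum>i\<le>Suc ?n. \<tau> ((d1 ^^ i) e) (coeff (pCons 0 P) i)) =
      (\<Sum>i\<le>?n. \<tau> (d1 ((d1 ^^ i) e)) (coeff P i))"
    by (subst sum.atMost_Suc_shift) (simp add: tau_zero_right)
  also have "(\<Sum>i\<le>Suc ?n. \<tau> ((d1 ^^ i) e) (d2 (coeff P i))) =
      (\<Sum>i\<le>?n. \<tau> ((d1 ^^ i) e) (d2 (coeff P i)))"
    by (simp add: coeff_eq_0 E2.d_zero tau_zero_right)
  also have "(\<Sum>i\<le>?n. \<tau> (d1 ((d1 ^^ i) e)) (coeff P i)) +
      (\<Sum>i\<le>?n. \<tau> ((d1 ^^ i) e) (d2 (coeff P i))) = D (insert_vec e P)"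
    by (simp add: insert_vec_def E3.d_sum D_tau sum.distrib)
  finally show ?thesis .
qed

lemma insert_vec_poly_action:
  "insert_vec e (poly_action E2.pscale (poly_shift d2) p P) = poly_action s3 D p (insert_vec e P)"
  by (rule poly_action_intertwine[OF linear_insert_vec, where S = UNIV])
    (simp_all add: insert_vec_shift)

text \<open>A functional on the right factor turns vector coefficients into scalars and the
  hypothesis into a K[t]-relation in \<open>E\<close>. Choosing it nonzero on a leading coefficient
  keeps that polynomial nonzero.\<close>

lemma insert_vec_free:
  assumes free: "\<forall>P. (\<Sum>e\<in>E. poly_action s1 d1 (P e) e) = 0 \<longrightarrow> (\<forall>e\<in>E. P e = 0)"
    and zero: "(\<Sum>e\<in>E. insert_vec e (R e)) = 0" and e: "e \<in> E"
  shows "R e = 0"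
proof (rule ccontr)
  assume "R e \<noteq> 0"
  then have "lead_coeff (R e) \<noteq> 0" by simp
  then obtain \<psi> where \<psi>: "Vector_Spaces.linear s2 (*) \<psi>" "\<psi> (lead_coeff (R e)) \<noteq> 0"
    using functional_nonzero by blast
  interpret \<psi>: Vector_Spaces.linear s2 "(*)" \<psi> by (rule \<psi>)
  obtain L where L: "Vector_Spaces.linear s3 s1 L" "\<And>a b. L (\<tau> a b) = s1 (\<psi> b) a"
    using contract_2[OF \<psi>(1)] by blast
  interpret L: Vector_Spaces.linear s3 s1 L by (rule L)
  have "L (insert_vec e P) = poly_action s1 d1 (map_poly \<psi> P) e" for e P
  proof -
    have "degree (map_poly \<psi> P) \<le> degree P"
      by (rule degree_le) (simp add: coeff_map_poly \<psi>.zero coeff_eq_0)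
    then show ?thesis
      by (simp add: insert_vec_def L.sum L(2) E1.poly_action_bound coeff_map_poly \<psi>.zero)
  qed
  then have "(\<Sum>e\<in>E. poly_action s1 d1 (map_poly \<psi> (R e)) e) = L (\<Sum>e\<in>E. insert_vec e (R e))"
    by (simp add: L.sum)
  then have "map_poly \<psi> (R e) = 0"
    using free[rule_format, of "\<lambda>e. map_poly \<psi> (R e)"] e zero L.zero by simp
  then show False
    using \<psi>(2) by (metis coeff_0 coeff_map_poly \<psi>.zero)
qed

text \<open>A nonzero polynomial in \<open>d1\<close> moves the left factors into a free \<open>K[t]\<close>-module,
  and on \<open>K[t] \<otimes> V\<close> the map \<open>t \<otimes> 1 + 1 \<otimes> d2\<close> has no torsion.\<close>

lemma torsion_left_factors:
  assumes tors: "(\<Sum>b\<in>B. \<tau> (f b) b) \<in> torsion s3 D"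
    and B: "finite B" "V2.independent B" and b: "b \<in> B"
  shows "f b \<in> torsion s1 d1"
proof -
  interpret F: tensor_pairing s2 s1 s3 "\<lambda>b a. \<tau> a b" by (rule flip)
  let ?x = "\<Sum>b\<in>B. \<tau> (f b) b"
  obtain p where p: "p \<noteq> 0" "poly_action s3 D p ?x = 0"
    using tors by (auto simp: torsion_def)
  obtain q E where q: "q \<noteq> 0" and E: "finite E"
    and free: "\<forall>P. (\<Sum>e\<in>E. poly_action s1 d1 (P e) e) = 0 \<longrightarrow> (\<forall>e\<in>E. P e = 0)"
    and fB: "\<forall>a\<in>f ` B. \<exists>P. poly_action s1 d1 q a = (\<Sum>e\<in>E. poly_action s1 d1 (P e) e)"
    using E1.free_submodule[OF finite_imageI[OF B(1), of f]] by (elim exE conjE) (rule that)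
  obtain P where P: "\<And>b. b \<in> B \<Longrightarrow> poly_action s1 d1 q (f b) = (\<Sum>e\<in>E. poly_action s1 d1 (P b e) e)"
    using bchoice[of B "\<lambda>b P. poly_action s1 d1 q (f b) = (\<Sum>e\<in>E. poly_action s1 d1 (P e) e)"] fB
    by blast
  \<comment> \<open>\<open>Q\<close> plays the role of \<open>q(d1) \<otimes> 1\<close>.\<close>
  obtain Q where Q: "Vector_Spaces.linear s3 s3 Q"
    "\<And>a b. Q (\<tau> a b) = \<tau> (poly_action s1 d1 q a) b"
    using extend_1[OF E1.linear_poly_action] by blast
  interpret Q: Vector_Spaces.linear s3 s3 Q by (rule Q)
  \<comment> \<open>\<open>R e\<close> collects what belongs to the generator \<open>e\<close>: it
    is the sum of \<open>P b e \<otimes> b\<close> in K[t] \<otimes> V, with V the right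
    factor.\<close>
  define R where "R e = (\<Sum>b\<in>B. map_poly (\<lambda>c. s2 c b) (P b e))" for e
  have insert_R: "insert_vec e (map_poly (\<lambda>c. s2 c b) r) = \<tau> (poly_action s1 d1 r e) b" for e b r
  proof -
    have "degree (map_poly (\<lambda>c. s2 c b) r) \<le> degree r"
      by (rule degree_le) (simp add: coeff_map_poly coeff_eq_0)
    then show ?thesis
      by (simp add: insert_vec_bound coeff_map_poly poly_action_def tau_sum_left tau_scale_left
          tau_scale_right)
  qed
  have Qx: "Q ?x = (\<Sum>e\<in>E. insert_vec e (R e))"
  proof -
    have "insert_vec e (R e) = (\<Sum>b\<in>B. \<tau> (poly_action s1 d1 (P b e) e) b)" for e
    proof -
      interpret I: Vector_Spaces.linear E2.pscale s3 "insert_vec e" by (rule linear_insert_vec)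
      show ?thesis by (simp add: R_def I.sum insert_R)
    qed
    then have "(\<Sum>e\<in>E. insert_vec e (R e)) =
        (\<Sum>b\<in>B. \<Sum>e\<in>E. \<tau> (poly_action s1 d1 (P b e) e) b)"
      by (simp add: sum.swap[of _ B E])
    also have "\<dots> = Q ?x"
      by (simp add: Q.sum Q(2) P tau_sum_left)
    finally show ?thesis ..
  qed
  \<comment> \<open>On pure tensors \<open>Q\<close> commutes with \<open>D\<close> because
    \<open>q(d1)\<close> commutes with \<open>d1\<close>; linearity extends this to their span,
    which \<open>D\<close> preserves.\<close>
  have "Q (poly_action s3 D p ?x) = poly_action s3 D p (Q ?x)"
  proof (rule poly_action_intertwine[OF Q(1), where S = "V3.span {\<tau> a b | a b. True}"])
    show "?x \<in> V3.span {\<tau> a b | a b. True}"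
      by (intro V3.span_sum V3.span_base) blast
    fix y assume "y \<in> V3.span {\<tau> a b | a b. True}"
    then show "D y \<in> V3.span {\<tau> a b | a b. True} \<and> Q (D y) = D (Q y)"
    proof (induction rule: V3.span_induct_alt)
      case base
      show ?case by (simp add: E3.d_zero Q.zero V3.span_zero)
    next
      case (step c t y)
      then obtain a b where t: "t = \<tau> a b" by blast
      have "poly_action s1 d1 q (d1 a) = d1 (poly_action s1 d1 q a)"
        using poly_action_intertwine[OF linear_d1, of UNIV d1 d1 a q] by simp
      then have "Q (D t) = D (Q t)"
        by (simp add: t D_tau Q.add Q(2))
      moreover have "D t \<in> V3.span {\<tau> a b | a b. True}"
        unfolding t D_tau by (intro V3.span_add V3.span_base) blast+
      ultimately show ?case
        using step by (simp add: E3.d_add E3.d_scale Q.add Q.scale V3.span_add V3.span_scale)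
    qed
  qed
  then have "poly_action s3 D p (\<Sum>e\<in>E. insert_vec e (R e)) = 0"
    using p(2) Q.zero Qx by simp
  then have "(\<Sum>e\<in>E. insert_vec e (poly_action E2.pscale (poly_shift d2) p (R e))) = 0"
    by (simp add: insert_vec_poly_action E3.poly_action_sum)
  then have "poly_action E2.pscale (poly_shift d2) p (R e) = 0" if "e \<in> E" for e
    by (rule insert_vec_free[OF free _ that])
  then have "R e = 0" if "e \<in> E" for e
    using E2.poly_shift_torsion_free p(1) that by blast
  then have "Q ?x = 0"
    unfolding Qx by (simp add: insert_vec_def tau_zero_right)
  then have "(\<Sum>b\<in>B. \<tau> (poly_action s1 d1 q (f b)) b) = 0"
    by (simp add: Q.sum Q(2))
  then have "poly_action s1 d1 q (f b) = 0"
    by (rule F.independent_tensor_zero[OF B(2,1) _ b])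
  then show ?thesis using q by (auto simp: torsion_def)
qed

text \<open>The factors are treated in turn. Independent right factors force torsion left factors;
  the tensor is then rewritten with independent torsion elements on the left, and the flipped
  argument makes the new right factors torsion.\<close>

lemma torsion_tensor_subset:
  assumes "x \<in> torsion s3 D" "x \<in> V3.span {\<tau> a b | a b. True}"
  shows "x \<in> V3.span {\<tau> a b | a b. a \<in> torsion s1 d1 \<and> b \<in> torsion s2 d2}"
proof -
  interpret F: tensor_derivation s2 s1 s3 "\<lambda>b a. \<tau> a b" d2 d1 D by (rule flip_derivation)
  have "{\<tau> a b | b a. b \<in> UNIV} = {\<tau> a b | a b. True}" by blast
  then have right: "x \<in> V3.span {\<tau> a b | b a. b \<in> UNIV}" using assms(2) by simp
  obtain B f where B: "finite B" "V2.independent B" and x: "x = (\<Sum>b\<in>B. \<tau> (f b) b)"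
    by (rule F.span_obtain_independent[OF V2.subspace_UNIV right]) (rule that)
  have "f b \<in> torsion s1 d1" if "b \<in> B" for b
    using torsion_left_factors[OF _ B that] assms(1) x by blast
  then have left: "x \<in> V3.span {\<tau> a b | a b. a \<in> torsion s1 d1}"
    unfolding x by (intro V3.span_sum V3.span_base) blast
  obtain A c where A: "finite A" "A \<subseteq> torsion s1 d1" "V1.independent A"
    and x': "x = (\<Sum>a\<in>A. \<tau> a (c a))"
    by (rule span_obtain_independent[OF E1.subspace_torsion left])
  have "c a \<in> torsion s2 d2" if "a \<in> A" for a
    using F.torsion_left_factors[OF _ A(1,3) that] assms(1) x' by blast
  then show ?thesis
    unfolding x' using A(2) by (intro V3.span_sum V3.span_base) blast
qed

text \<open>The products of two finite spanning sets of invariant subspaces span a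
  \<open>D\<close>-invariant subspace, so no annihilating polynomial of \<open>D\<close> has to be
  written down.\<close>

lemma tau_torsion:
  assumes "a \<in> torsion s1 d1" "b \<in> torsion s2 d2"
  shows "\<tau> a b \<in> torsion s3 D"
proof -
  obtain A where A: "finite A" "a \<in> V1.span A" "\<And>y. y \<in> V1.span A \<Longrightarrow> d1 y \<in> V1.span A"
    by (rule E1.torsion_obtain_invariant[OF assms(1)]) blast
  obtain B where B: "finite B" "b \<in> V2.span B" "\<And>y. y \<in> V2.span B \<Longrightarrow> d2 y \<in> V2.span B"
    by (rule E2.torsion_obtain_invariant[OF assms(2)]) blast
  let ?S = "(\<lambda>(x, y). \<tau> x y) ` (A \<times> B)"
  have S: "\<tau> x y \<in> V3.span ?S" if x: "x \<in> V1.span A" and y: "y \<in> V2.span B" for x y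
  proof -
    have "\<tau> x' y \<in> V3.span ?S" if "x' \<in> A" for x'
      using y
    proof (induction rule: V2.span_induct_alt)
      case base
      show ?case by (simp add: tau_zero_right V3.span_zero)
    next
      case (step c y' z)
      have "\<tau> x' y' \<in> V3.span ?S" using step that by (intro V3.span_base) auto
      then show ?case
        unfolding tau_add_right tau_scale_right using step by (intro V3.span_add V3.span_scale)
    qed
    with x show ?thesis
      by (induction rule: V1.span_induct_alt)
        (auto simp: tau_zero_left tau_add_left tau_scale_left
          intro: V3.span_zero V3.span_add V3.span_scale)
  qed
  show ?thesis
  proof (rule E3.finite_invariant_imp_torsion)
    show "finite ?S" using A B by simp
    show "\<tau> a b \<in> V3.span ?S" using S A B by blast
    fix t assume "t \<in> ?S"
    then obtain x y where t: "t = \<tau> x y" "x \<in> A" "y \<in> B" by auto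
    show "D t \<in> V3.span ?S"
      unfolding t D_tau
      by (intro V3.span_add S A(3) B(3) V1.span_base V2.span_base t)
  qed
qed

text \<open>The intersection is taken because the ambient type may be larger than the span of the
  pure tensors, and \<open>D_tau\<close> determines \<open>D\<close> only on that span.\<close>

theorem torsion_tensor:
  "V3.span {\<tau> a b | a b. True} \<inter> torsion s3 D =
    V3.span {\<tau> a b | a b. a \<in> torsion s1 d1 \<and> b \<in> torsion s2 d2}"
proof (intro subset_antisym subsetI IntI)
  fix x assume x: "x \<in> V3.span {\<tau> a b | a b. a \<in> torsion s1 d1 \<and> b \<in> torsion s2 d2}"
  show "x \<in> V3.span {\<tau> a b | a b. True}"
    by (rule subsetD[OF V3.span_mono x]) blast
  show "x \<in> torsion s3 D"
    by (rule subsetD[OF V3.span_minimal[OF _ E3.subspace_torsion] x]) (auto intro: tau_torsion)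
next
  fix x assume "x \<in> V3.span {\<tau> a b | a b. True} \<inter> torsion s3 D"
  then show "x \<in> V3.span {\<tau> a b | a b. a \<in> torsion s1 d1 \<and> b \<in> torsion s2 d2}"
    by (intro torsion_tensor_subset) simp_all
qed

end

section \<open>The adjoint action on the tensor product\<close>

text \<open>All four families of maps come from the universal property, each applied to the bilinear
  map that its values on pure tensors prescribe.\<close>

lemma tensor_pairing_pure_tensor:
  assumes vs: "vector_space s1" "vector_space s2"
  shows "tensor_pairing s1 s2 tensor_scale (pure_tensor s1 s2)"
proof
  note p = pure_tensor_bilinear[OF vs, unfolded bilinear_map_iff[OF vs vector_space_tensor]]
  interpret V1: vector_space s1 by (rule vs)
  interpret V2: vector_space s2 by (rule vs)
  show "bilinear_map s1 s2 tensor_scale (pure_tensor s1 s2)"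
    by (rule pure_tensor_bilinear[OF vs])
  show "\<exists>L. Vector_Spaces.linear tensor_scale s2 L \<and>
      (\<forall>a b. L (pure_tensor s1 s2 a b) = s2 (\<phi> a) b)"
    if "Vector_Spaces.linear s1 (*) \<phi>" for \<phi>
    by (rule tensor_universal(1)[OF vs])
      (use that in \<open>auto simp: bilinear_map_iff[OF vs vs(2)] linear_iff_add_scale V2.scale_left_distrib
        V2.scale_right_distrib mult.commute\<close>)
  show "\<exists>L. Vector_Spaces.linear tensor_scale s1 L \<and>
      (\<forall>a b. L (pure_tensor s1 s2 a b) = s1 (\<psi> b) a)"
    if "Vector_Spaces.linear s2 (*) \<psi>" for \<psi>
    by (rule tensor_universal(1)[OF vs])
      (use that in \<open>auto simp: bilinear_map_iff[OF vs vs(1)] linear_iff_add_scale V1.scale_left_distrib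
        V1.scale_right_distrib mult.commute\<close>)
  show "\<exists>L. Vector_Spaces.linear tensor_scale tensor_scale L \<and>
      (\<forall>a b. L (pure_tensor s1 s2 a b) = pure_tensor s1 s2 (f a) b)"
    if "Vector_Spaces.linear s1 s1 f" for f
    by (rule tensor_universal(1)[OF vs])
      (use that p in \<open>auto simp: bilinear_map_iff[OF vs vector_space_tensor] linear_iff_add_scale\<close>)
  show "\<exists>L. Vector_Spaces.linear tensor_scale tensor_scale L \<and>
      (\<forall>a b. L (pure_tensor s1 s2 a b) = pure_tensor s1 s2 a (g b))"
    if "Vector_Spaces.linear s2 s2 g" for g
    by (rule tensor_universal(1)[OF vs])
      (use that p in \<open>auto simp: bilinear_map_iff[OF vs vector_space_tensor] linear_iff_add_scale\<close>)
qed

section \<open>Brackets with 1 and with \<open>z1 \<otimes> 1 + 1 \<otimes> z2\<close>\<close>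

lemma (in nc_poisson_algebra) bracket_simps:
  "bracket (x + y) z = bracket x z + bracket y z"
  "bracket x (y + z) = bracket x y + bracket x z"
  "bracket (scale c x) y = scale c (bracket x y)"
  "bracket x (scale c y) = scale c (bracket x y)"
  using bracket_bilinear
  unfolding bilinear_map_iff[OF vector_space_axioms vector_space_axioms vector_space_axioms] by auto

text \<open>The Leibniz rule for \<open>1 * 1\<close> gives
  \<open>bracket x 1 = bracket x 1 + bracket x 1\<close>, so this bracket is 0; antisymmetry, from
  expanding the bracket of \<open>1 + x\<close> with itself, moves 1 to the left.\<close>

lemma (in nc_poisson_algebra) bracket_one_left: "bracket 1 x = 0"
proof -
  have "bracket 1 x + bracket x 1 = 0"
    using bracket_self[of "1 + x"] unfolding bracket_simps by (simp add: bracket_self add.commute)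
  moreover have "bracket x 1 = 0"
    using leibniz[of x 1 1] by simp
  ultimately show ?thesis by simp
qed

context
  fixes s1 :: "'k::field \<Rightarrow> 'a::{ring, monoid_mult} \<Rightarrow> 'a"
    and s2 :: "'k \<Rightarrow> 'b::{ring, monoid_mult} \<Rightarrow> 'b"
    and br1 :: "'a \<Rightarrow> 'a \<Rightarrow> 'a" and br2 :: "'b \<Rightarrow> 'b \<Rightarrow> 'b"
  assumes P1: "nc_poisson_algebra s1 br1" and P2: "nc_poisson_algebra s2 br2"
begin

interpretation P1: nc_poisson_algebra s1 br1 by (rule P1)
interpretation P2: nc_poisson_algebra s2 br2 by (rule P2)
interpretation T: vector_space "tensor_scale :: 'k \<Rightarrow> ('k, 'a, 'b) tensor \<Rightarrow> _"
  by (rule vector_space_tensor)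
interpretation pure: tensor_pairing s1 s2 tensor_scale "pure_tensor s1 s2"
  by (rule tensor_pairing_pure_tensor[OF P1.vector_space_axioms P2.vector_space_axioms])

lemma flip_mult_bilinear: "bilinear_map s1 s1 s1 (\<lambda>a b. b * a)"
  using P1.mult_bilinear by (simp add: bilinear_map_def)

lemmas op_bilinear = tensor_op_bilinear[OF P1.vector_space_axioms P2.vector_space_axioms]
lemmas op_pure = tensor_op_pure[OF P1.vector_space_axioms P2.vector_space_axioms]

lemma subspace_tensor_space: "T.subspace (tensor_space s1 s2)"
  unfolding tensor_space_def tensor_of_def by (rule T.subspace_span)

lemma pure_tensor_space: "pure_tensor s1 s2 a b \<in> tensor_space s1 s2"
  by (rule pure_in_tensor_space[OF P1.vector_space_axioms P2.vector_space_axioms])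

text \<open>In both classes the bracket is a combination of values of \<open>tensor_op\<close>,
  whose bilinearity is available for members of \<open>tensor_space\<close>.\<close>

lemma tensor_bracket_right_linear:
  assumes u: "u \<in> tensor_space s1 s2" and v: "v \<in> tensor_space s1 s2" and w: "w \<in> tensor_space s1 s2"
  shows "tensor_bracket s1 s2 br1 br2 u (v + w) =
      tensor_bracket s1 s2 br1 br2 u v + tensor_bracket s1 s2 br1 br2 u w"
    and "tensor_bracket s1 s2 br1 br2 u (tensor_scale c v) =
      tensor_scale c (tensor_bracket s1 s2 br1 br2 u v)"
  unfolding tensor_bracket_def tensor_mult_def
  by (simp_all add: op_bilinear(2)[OF P1.bracket_bilinear P2.mult_bilinear u u v w]
      op_bilinear(2)[OF flip_mult_bilinear P2.bracket_bilinear u u v w]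
      op_bilinear(2)[OF P1.mult_bilinear P2.mult_bilinear u u v w]
      op_bilinear(1)[OF P1.mult_bilinear P2.mult_bilinear v w u u]
      op_bilinear(4)[OF P1.bracket_bilinear P2.mult_bilinear u u v v]
      op_bilinear(4)[OF flip_mult_bilinear P2.bracket_bilinear u u v v]
      op_bilinear(4)[OF P1.mult_bilinear P2.mult_bilinear u u v v]
      op_bilinear(3)[OF P1.mult_bilinear P2.mult_bilinear v v u u]
      T.scale_right_distrib T.scale_right_diff_distrib algebra_simps)

text \<open>For class 1 the mixed terms contain a bracket with 1 and vanish. For class 2
  multiplication by 1 leaves the other factor unchanged, so each commutator reduces to one in a
  single factor.\<close>

lemma tensor_bracket_Gamma_pure:
  assumes cls: "class_1 br1 \<and> class_1 br2 \<or> class_2 br1 \<and> class_2 br2"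
  shows "tensor_bracket s1 s2 br1 br2 (pure_tensor s1 s2 z1 1 + pure_tensor s1 s2 1 z2)
      (pure_tensor s1 s2 a b) = pure_tensor s1 s2 (br1 z1 a) b + pure_tensor s1 s2 a (br2 z2 b)"
proof (cases "class_1 br1 \<and> class_1 br2")
  note p = pure_tensor_space
  case True
  then show ?thesis
    unfolding tensor_bracket_def
    by (simp add: op_bilinear(1)[OF P1.bracket_bilinear P2.mult_bilinear p p p p]
        op_bilinear(1)[OF flip_mult_bilinear P2.bracket_bilinear p p p p]
        op_pure[OF P1.bracket_bilinear P2.mult_bilinear]
        op_pure[OF flip_mult_bilinear P2.bracket_bilinear]
        P1.bracket_one_left P2.bracket_one_left pure.tau_zero_left pure.tau_zero_right)
next
  note p = pure_tensor_space
  case False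
  then have br: "\<And>x y. br1 x y = x * y - y * x" "\<And>x y. br2 x y = x * y - y * x"
    using cls by (auto simp: class_2_def)
  have diff: "pure_tensor s1 s2 (x - y) b = pure_tensor s1 s2 x b - pure_tensor s1 s2 y b"
    "pure_tensor s1 s2 a (v - w) = pure_tensor s1 s2 a v - pure_tensor s1 s2 a w" for x y v w
    using pure.tau_add_left[of "x - y" y b] pure.tau_add_right[of a "v - w" w] by simp_all
  show ?thesis
    unfolding tensor_bracket_def tensor_mult_def if_not_P[OF False]
    by (simp add: op_bilinear(1,2)[OF P1.mult_bilinear P2.mult_bilinear p p p p]
        op_pure[OF P1.mult_bilinear P2.mult_bilinear] br diff)
qed

text \<open>The adjoint map is known to be linear only on \<open>tensor_space\<close>, while the
  torsion results concern a linear map on the whole type. The universal property supplies such a map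
  \<open>D\<close> that agrees with it on \<open>tensor_space\<close>.\<close>

lemma ad_finite_tensor:
  assumes cls: "class_1 br1 \<and> class_1 br2 \<or> class_2 br1 \<and> class_2 br2"
  shows "ad_finite tensor_scale (tensor_space s1 s2) (tensor_bracket s1 s2 br1 br2)
      (pure_tensor s1 s2 z1 1 + pure_tensor s1 s2 1 z2) =
    tensor_of s1 s2 (ad_finite s1 UNIV br1 z1) (ad_finite s2 UNIV br2 z2)"
proof -
  let ?\<Gamma> = "pure_tensor s1 s2 z1 1 + pure_tensor s1 s2 1 z2"
  let ?ad = "tensor_bracket s1 s2 br1 br2 ?\<Gamma>"
  have lin: "Vector_Spaces.linear s1 s1 (br1 z1)" "Vector_Spaces.linear s2 s2 (br2 z2)"
    using P1.bracket_bilinear P2.bracket_bilinear by (auto simp: bilinear_map_def)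
  have "bilinear_map s1 s2 tensor_scale
      (\<lambda>a b. pure_tensor s1 s2 (br1 z1 a) b + pure_tensor s1 s2 a (br2 z2 b))"
    unfolding bilinear_map_iff[OF P1.vector_space_axioms P2.vector_space_axioms vector_space_tensor]
    by (simp add: P1.bracket_simps P2.bracket_simps pure.tau_add_left pure.tau_add_right
        pure.tau_scale_left pure.tau_scale_right T.scale_right_distrib algebra_simps)
  from tensor_universal(1)[OF P1.vector_space_axioms P2.vector_space_axioms this]
  obtain D where D: "Vector_Spaces.linear tensor_scale tensor_scale D"
    "\<And>a b. D (pure_tensor s1 s2 a b) =
      pure_tensor s1 s2 (br1 z1 a) b + pure_tensor s1 s2 a (br2 z2 b)"
    by (elim exE conjE) (rule that, assumption, erule allE, erule allE)
  interpret D: tensor_derivation s1 s2 tensor_scale "pure_tensor s1 s2" "br1 z1" "br2 z2" D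
    by (intro tensor_derivation.intro tensor_derivation_axioms.intro
        pure.tensor_pairing_axioms lin D)
  have \<Gamma>: "?\<Gamma> \<in> tensor_space s1 s2"
    by (intro T.subspace_add[OF subspace_tensor_space] pure_tensor_space)
  have ad: "?ad v = D v \<and> D v \<in> tensor_space s1 s2" if "v \<in> tensor_space s1 s2" for v
    using that
  proof (induction rule: tensor_induct[OF P1.vector_space_axioms P2.vector_space_axioms,
        consumes 1, case_names zero add])
    case zero
    have "?ad (tensor_scale 0 0) = tensor_scale 0 (?ad 0)"
      by (rule tensor_bracket_right_linear(2)[OF \<Gamma>])
        (rule T.subspace_0[OF subspace_tensor_space])+
    then have "?ad 0 = 0" by (simp only: T.scale_zero_left)
    then show ?case
      by (simp only: D.E3.d_zero T.subspace_0[OF subspace_tensor_space] simp_thms)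
  next
    case (add c a b v)
    have p: "tensor_scale c (pure_tensor s1 s2 a b) \<in> tensor_space s1 s2"
      by (intro T.subspace_scale[OF subspace_tensor_space] pure_tensor_space)
    show ?case
      unfolding tensor_bracket_right_linear(1)[OF \<Gamma> p add.hyps]
        tensor_bracket_right_linear(2)[OF \<Gamma> pure_tensor_space pure_tensor_space]
        tensor_bracket_Gamma_pure[OF cls] D.E3.d_add D.E3.d_scale D(2)
        conjunct1[OF add.IH]
      by (intro conjI refl T.subspace_add[OF subspace_tensor_space]
          T.subspace_scale[OF subspace_tensor_space] pure_tensor_space conjunct2[OF add.IH])
  qed
  define A where "A = ?ad"
  \<comment> \<open>Iterates never leave \<open>tensor_space\<close>, so the two maps have the same
    orbits there.\<close>
  have "(A ^^ i) x = (D ^^ i) x \<and> (D ^^ i) x \<in> tensor_space s1 s2"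
    if "x \<in> tensor_space s1 s2" for i x
    by (induction i) (simp_all add: that ad[folded A_def])
  then have "poly_orbit tensor_scale A x = poly_orbit tensor_scale D x"
    if "x \<in> tensor_space s1 s2" for x
    using that by (simp add: poly_orbit_def)
  then have "ad_finite tensor_scale (tensor_space s1 s2) (tensor_bracket s1 s2 br1 br2) ?\<Gamma> =
      tensor_space s1 s2 \<inter> torsion tensor_scale D"
    unfolding ad_finite_def A_def[symmetric] by (auto simp: D.E3.fin_dim_iff_torsion)
  moreover have "ad_finite s1 UNIV br1 z1 = torsion s1 (br1 z1)"
    "ad_finite s2 UNIV br2 z2 = torsion s2 (br2 z2)"
    by (simp_all add: ad_finite_def D.E1.fin_dim_iff_torsion D.E2.fin_dim_iff_torsion)
  ultimately show ?thesis
    using D.torsion_tensor by (simp add: tensor_space_def tensor_of_def)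
qed

end

theorem theorem6p1:
  fixes s1 :: "'k::{alg_closed_field, field_char_0} \<Rightarrow> 'a::{ring, monoid_mult} \<Rightarrow> 'a"
    and s2 :: "'k \<Rightarrow> 'b::{ring, monoid_mult} \<Rightarrow> 'b"
    and br1 :: "'a \<Rightarrow> 'a \<Rightarrow> 'a" and br2 :: "'b \<Rightarrow> 'b \<Rightarrow> 'b"
    and u1 :: "'a \<Rightarrow> int extended" and u2 :: "'b \<Rightarrow> int extended"
    and z1 :: 'a and z2 :: 'b
  assumes "nc_poisson_algebra s1 br1" and "nc_poisson_algebra s2 br2"
    and "class_1 br1 \<and> class_1 br2 \<or> class_2 br1 \<and> class_2 br2"
    and "degree_map br1 u1" and "degree_map br2 u2"
    and "\<forall>x. u1 x = Minf \<or> 0 \<le> u1 x" and "\<forall>y. u2 y = Minf \<or> 0 \<le> u2 y"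
    and "finite_filtration s1 u1" and "discrete_filtration u1"
    and "finite_filtration s2 u2" and "discrete_filtration u2"
  shows "ad_finite tensor_scale (tensor_space s1 s2) (tensor_bracket s1 s2 br1 br2)
      (pure_tensor s1 s2 z1 1 + pure_tensor s1 s2 1 z2) =
    tensor_of s1 s2 (ad_finite s1 UNIV br1 z1) (ad_finite s2 UNIV br2 z2)"
  using assms(1-3) by (rule ad_finite_tensor)

end
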